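(* Under the same conditions as in the asymptotic normality result for $(\hat A,\hat C,\hat B)$ (model correctly specified, $\boldsymbol\Sigma$ known, $Z^\top Z/n\to q>0$), let $\hat C'=Z^\top R/(Z^\top Z)$ and $$\hat C=\frac{M^\top M\,Z^\top R-Z^\top M\,M^\top R}{Z^\top Z\,M^\top M-(Z^\top M)^2}+\frac{\delta\sigma_2\,Z^\top M}{\sigma_1\,Z^\top Z}.$$ Then $$\sqrt n\left(\begin{pmatrix}\hat C'\\ \hat C\end{pmatrix}-\begin{pmatrix}C+AB\\ C\end{pmatrix}\right)\xrightarrow{\mathcal D}\mathcal N(\mathbf 0,\boldsymbol V'),$$ where $$\boldsymbol V'=\begin{pmatrix}(B^2\sigma_1^2+2B\delta\sigma_1\sigma_2+\sigma_2^2)/q & (\sigma_2^2+B\delta\sigma_1\sigma_2)/q\\ (\sigma_2^2+B\delta\sigma_1\sigma_2)/q & \sigma_2^2(qA^2+\sigma_1^2-qA^2\delta^2)/(q\sigma_1^2)\end{pmatrix}.$$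
   Context: Single-level mediation model: $Z\in\mathbb{R}^n$ is a (fixed, observed) treatment-assignment vector; $M\in\mathbb{R}^n$ (mediator) and $R\in\mathbb{R}^n$ (outcome) are observed vectors satisfying $$M=ZA+E_1,\qquad R=ZC+MB+E_2,$$ with unknown scalar coefficients $A,B,C$. The errors satisfy $\operatorname{vec}(E_1\ E_2)\sim\mathcal{N}(\mathbf 0,\boldsymbol{\Sigma}\otimes I_n)$ with $\boldsymbol{\Sigma}=\begin{pmatrix}\sigma_1^2&\delta\sigma_1\sigma_2\\ \delta\sigma_1\sigma_2&\sigma_2^2\end{pmatrix}$, $\sigma_1,\sigma_2>0$, $\delta\in(-1,1)$; i.e. the $n$ pairs $(E_{1,j},E_{2,j})$ are i.i.d. bivariate normal with mean zero and covariance $\boldsymbol{\Sigma}$, independent of $Z$. The total effect is $C'=C+AB$. *)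

theory Defs
  imports "HOL-Probability.Probability"
begin

definition normal_law :: "real \<Rightarrow> real measure" where
  "normal_law v = (if v = 0 then return borel 0
                   else density lborel (normal_density 0 (sqrt v)))"

text \<open>Bivariate centered Gaussian law with covariance matrix [[v11, v12], [v12, v22]]:
  a probability measure on R^2 all of whose linear functionals a x + b y are centered normal
  with variance a^2 v11 + 2 a b v12 + b^2 v22 (standard definition of a Gaussian vector).\<close>
definition gaussian2 :: "(real \<times> real) measure \<Rightarrow> real \<Rightarrow> real \<Rightarrow> real \<Rightarrow> bool" where
  "gaussian2 \<mu> v11 v12 v22 \<longleftrightarrow>
     sets \<mu> = sets borel \<and> prob_space \<mu> \<and>
     (\<forall>a b. distr \<mu> borel (\<lambda>(x, y). a * x + b * y)
              = normal_law (a\<^sup>2 * v11 + 2 * a * b * v12 + b\<^sup>2 * v22))"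

definition conv_distr2 ::
  "'a measure \<Rightarrow> (nat \<Rightarrow> 'a \<Rightarrow> real \<times> real) \<Rightarrow> (real \<times> real) measure \<Rightarrow> bool" where
  "conv_distr2 P X \<mu> \<longleftrightarrow>
     (\<forall>f :: real \<times> real \<Rightarrow> real. continuous_on UNIV f \<and> bounded (range f) \<longrightarrow>
        (\<lambda>n. \<integral>\<omega>. f (X n \<omega>) \<partial>P) \<longlonglongrightarrow> (\<integral>x. f x \<partial>\<mu>))"

end

theory Submission
  imports Defs
begin

text \<open>Write the second error as \<open>E\<^sub>2 = \<gamma> E\<^sub>1 + F\<close> with \<open>\<gamma> = \<delta> \<sigma>\<^sub>2 / \<sigma>\<^sub>1\<close> and \<open>F\<close> independent of \<open>E\<^sub>1\<close>.
  Both estimation errors, scaled by \<open>sqrt n\<close>, are linear in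
  \<open>Z\<^sup>T E\<^sub>1 / sqrt n\<close>, \<open>Z\<^sup>T F / sqrt n\<close> and \<open>E\<^sub>1\<^sup>T F / sqrt n\<close>, with coefficients that are continuous functions of
  \<open>Z\<^sup>T Z / n\<close>, \<open>Z\<^sup>T E\<^sub>1 / n\<close> and \<open>E\<^sub>1\<^sup>T E\<^sub>1 / n\<close> and hence converge in probability.
  No Lindeberg condition on \<open>Z\<close> is available, but none is needed: given \<open>E\<^sub>1\<close> the statistics
  \<open>Z\<^sup>T F\<close> and \<open>E\<^sub>1\<^sup>T F\<close> are exactly Gaussian, so their joint characteristic function is
  an expectation over \<open>E\<^sub>1\<close> alone, which converges because the conditional variance does.
  Independence of \<open>E\<^sub>1\<close> and \<open>F\<close>, and convergence in law in the plane, follow from a bivariate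
  Levy continuity theorem, proved by approximating test functions by trigonometric polynomials.\<close>

section \<open>A continuity theorem for characteristic functions on the plane\<close>

text \<open>\<open>gaussian2\<close> describes an error pair only through its linear functionals,
  hence through its characteristic function. Independence of \<open>E1\<close> and the residual is
  therefore never established as such: the continuity theorem, applied to a constant sequence, shows
  that a characteristic function determines the law on the plane, so expectations over a pair may be
  computed under a product of two normal laws. \<open>Z\<close> has a new row for every
  \<open>n\<close>, and only the average of its squares is controlled. Single weights may dominate a
  row, so the linear statistics in \<open>Z\<close> are handled by exact Gaussian formulas at each
  \<open>n\<close>. The denominators of the corrected estimator are random and may vanish; for
  \<open>n = 1\<close> the Gram determinant of \<open>Z\<close> and \<open>M\<close> is always 0.
  The representation by three statistics thus holds only off events whose probability tends to 0,
  and the Slutsky argument is built to tolerate such events.\<close>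

inductive trig_poly :: "(real \<times> real \<Rightarrow> complex) \<Rightarrow> bool" where
  monom: "trig_poly (\<lambda>z. c * iexp (s * fst z + t * snd z))"
| add: "trig_poly f \<Longrightarrow> trig_poly g \<Longrightarrow> trig_poly (\<lambda>z. f z + g z)"

lemma trig_poly_const: "trig_poly (\<lambda>z. c)"
  using trig_poly.monom[of c 0 0] by simp

lemma trig_poly_mult_monom:
  assumes "trig_poly f"
  shows "trig_poly (\<lambda>z. f z * (c * iexp (s * fst z + t * snd z)))"
  using assms
proof induction
  case (monom c' s' t')
  have "(\<lambda>z. c' * iexp (s' * fst z + t' * snd z) * (c * iexp (s * fst z + t * snd z)))
      = (\<lambda>z. (c' * c) * iexp ((s' + s) * fst z + (t' + t) * snd z))"
    by (auto simp: fun_eq_iff exp_add[symmetric] algebra_simps)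
  then show ?case
    by (simp only: trig_poly.monom)
next
  case (add f g)
  from trig_poly.add[OF add.IH] show ?case
    by (simp only: distrib_right)
qed

text \<open>Derived rather than taken as an introduction rule, so that an induction over
  \<open>trig_poly\<close> meets only exponentials and sums, to which linearity of the integral
  applies.\<close>

lemma trig_poly_mult:
  assumes "trig_poly f" "trig_poly g"
  shows "trig_poly (\<lambda>z. f z * g z)"
  using assms(2)
proof induction
  case (monom c s t)
  show ?case
    by (rule trig_poly_mult_monom[OF assms(1)])
next
  case (add g h)
  from trig_poly.add[OF add.IH] show ?case
    by (simp only: distrib_left)
qed

lemma trig_poly_Re_Im_iexp:
  "trig_poly (\<lambda>z. of_real (Re (iexp (a * fst z))))"
  "trig_poly (\<lambda>z. of_real (Im (iexp (a * fst z))))"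
  "trig_poly (\<lambda>z. of_real (Re (iexp (a * snd z))))"
  "trig_poly (\<lambda>z. of_real (Im (iexp (a * snd z))))"
proof -
  have Re_eq: "complex_of_real (Re (iexp x)) = 1/2 * iexp x + 1/2 * iexp (- x)" for x
    by (auto simp: complex_eq_iff Re_exp Im_exp)
  have Im_eq: "complex_of_real (Im (iexp x)) = -\<i>/2 * iexp x + \<i>/2 * iexp (- x)" for x
    by (auto simp: complex_eq_iff Re_exp Im_exp)
  have fst_monom: "trig_poly (\<lambda>z. c * iexp (b * fst z))" for c b
    using trig_poly.monom[of c b 0] by simp
  have snd_monom: "trig_poly (\<lambda>z. c * iexp (b * snd z))" for c b
    using trig_poly.monom[of c 0 b] by simp
  show "trig_poly (\<lambda>z. of_real (Re (iexp (a * fst z))))"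
    using trig_poly.add[OF fst_monom[of "1/2" a] fst_monom[of "1/2" "-a"]]
    unfolding Re_eq by simp
  show "trig_poly (\<lambda>z. of_real (Im (iexp (a * fst z))))"
    using trig_poly.add[OF fst_monom[of "-\<i>/2" a] fst_monom[of "\<i>/2" "-a"]]
    unfolding Im_eq by simp
  show "trig_poly (\<lambda>z. of_real (Re (iexp (a * snd z))))"
    using trig_poly.add[OF snd_monom[of "1/2" a] snd_monom[of "1/2" "-a"]]
    unfolding Re_eq by simp
  show "trig_poly (\<lambda>z. of_real (Im (iexp (a * snd z))))"
    using trig_poly.add[OF snd_monom[of "-\<i>/2" a] snd_monom[of "\<i>/2" "-a"]]
    unfolding Im_eq by simp
qed

text \<open>A real-linear functional on pairs of complex numbers is a combination of four real and
  imaginary parts. At points of the torus these are cosines and sines of the two angles, and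
  products of them expand again into exponentials.\<close>

lemma trig_poly_real_polynomial:
  fixes p :: "complex \<times> complex \<Rightarrow> real"
  assumes "real_polynomial_function p"
  shows "trig_poly (\<lambda>z. of_real (p (iexp (a * fst z), iexp (a * snd z))))"
  using assms
proof induction
  case (linear f)
  interpret bounded_linear f by fact
  have "f (z, w) = Re z * f (1, 0) + Im z * f (\<i>, 0) + (Re w * f (0, 1) + Im w * f (0, \<i>))"
    for z w
  proof -
    have "(z, w) = Re z *\<^sub>R (1, 0) + Im z *\<^sub>R (\<i>, 0) + (Re w *\<^sub>R (0, 1) + Im w *\<^sub>R (0, \<i>))"
      by (auto simp: complex_eq_iff)
    then show ?thesis
      by (simp only: add scaleR real_scaleR_def)
  qed
  then obtain c1 c2 c3 c4 where
    decomp: "\<And>z w. f (z, w) = Re z * c1 + Im z * c2 + (Re w * c3 + Im w * c4)"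
    by blast
  show ?case
    unfolding decomp of_real_add of_real_mult[of "Re _"] of_real_mult[of "Im _"]
    by (intro trig_poly.add trig_poly_mult trig_poly_Re_Im_iexp trig_poly_const)
next
  case (const c)
  show ?case by (rule trig_poly_const)
next
  case (add f g)
  from trig_poly.add[OF add.IH] show ?case by simp
next
  case (mult f g)
  from trig_poly_mult[OF mult.IH] show ?case by simp
qed

text \<open>Multiplying by a cutoff that vanishes near the antipode of 1 makes the
  transport of \<open>f\<close> to the torus continuous despite the branch cut of \<^const>\<open>Arg\<close>.\<close>

lemma trig_poly_approx:
  fixes f :: "real \<times> real \<Rightarrow> real"
  assumes cont: "continuous_on UNIV f" and bound: "\<And>z. \<bar>f z\<bar> \<le> D" and "0 < e" "0 < T"
  obtains h where "trig_poly h"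
    "\<And>z. \<bar>fst z\<bar> \<le> T \<Longrightarrow> \<bar>snd z\<bar> \<le> T \<Longrightarrow> cmod (h z - of_real (f z)) \<le> e"
    "\<And>z. cmod (h z) \<le> D + e"
proof -
  \<comment> \<open>\<open>\<kappa>\<close> is 1 where \<open>Re z >= 1/2\<close>, on the unit
    circle the angles up to pi/3, and 0 where \<open>Re z <= 0\<close>. The factor \<open>a\<close>
    compresses the interval from \<open>-T\<close> to \<open>T\<close> into exactly those
    angles.\<close>
  define \<kappa> where "\<kappa> z = min 1 (max 0 (2 * Re z))" for z
  define a where "a = pi / (3 * T)"
  have "a > 0" using \<open>0 < T\<close> by (simp add: a_def)
  define G where "G = (\<lambda>(z, w). \<kappa> z * \<kappa> w * f (Arg z / a, Arg w / a))"
  \<comment> \<open>Two open sets cover the torus: on \<open>U\<close> the cutoff makes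
    \<open>G\<close> vanish, on \<open>W\<close> both arguments stay off the branch cut. The only
    point of the unit circle on the cut is -1, which has negative real part.\<close>
  define U where "U = {v::complex \<times> complex. Re (fst v) < 0} \<union> {v. Re (snd v) < 0}"
  define W where "W = (- \<real>\<^sub>\<le>\<^sub>0 :: complex set) \<times> (- \<real>\<^sub>\<le>\<^sub>0 :: complex set)"
  let ?S = "sphere 0 1 \<times> sphere 0 1 :: (complex \<times> complex) set"
  have "open U"
    unfolding U_def by (intro open_Un open_Collect_less continuous_intros)
  have "open W"
    unfolding W_def by (intro open_Times) (auto intro: closed_nonpos_Reals_complex)
  have "G v = 0" if "v \<in> U" for v
    using that by (cases v) (auto simp: U_def G_def \<kappa>_def)
  then have "continuous_on U G"
    by (simp add: continuous_on_cong[where g="\<lambda>_. 0"])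
  moreover have "continuous_on W G"
    unfolding G_def \<kappa>_def W_def case_prod_beta using \<open>a > 0\<close>
    by (intro continuous_intros continuous_on_compose2[OF cont]) auto
  ultimately have "continuous_on (U \<union> W) G"
    using \<open>open U\<close> \<open>open W\<close> by (intro continuous_on_open_Un)
  moreover have "?S \<subseteq> U \<union> W"
  proof
    fix v :: "complex \<times> complex" assume "v \<in> ?S"
    moreover have "Re z < 0" if "z \<in> \<real>\<^sub>\<le>\<^sub>0" "norm z = 1" for z :: complex
      using that by (cases "Re z = 0") (auto simp: complex_nonpos_Reals_iff cmod_def)
    ultimately show "v \<in> U \<union> W"
      by (cases v) (auto simp: U_def W_def)
  qed
  ultimately have "continuous_on ?S G"
    by (rule continuous_on_subset)
  moreover have "compact ?S"
    by (intro compact_Times compact_sphere)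
  ultimately obtain p where p: "real_polynomial_function p" "\<And>v. v \<in> ?S \<Longrightarrow> \<bar>G v - p v\<bar> < e"
    using Stone_Weierstrass_real_polynomial_function[of ?S G e] \<open>0 < e\<close> by metis
  define h where "h z = complex_of_real (p (iexp (a * fst z), iexp (a * snd z)))" for z
  have near: "cmod (h z - of_real (G (iexp (a * fst z), iexp (a * snd z)))) \<le> e" for z
    using p(2)[of "(iexp (a * fst z), iexp (a * snd z))"]
    unfolding h_def of_real_diff[symmetric] norm_of_real by (auto simp: abs_minus_commute)
  have "0 \<le> \<kappa> z" "\<kappa> z \<le> 1" for z by (auto simp: \<kappa>_def)
  then have "\<bar>\<kappa> z * \<kappa> w * f v\<bar> \<le> 1 * 1 * D" for z w v
    unfolding abs_mult using bound by (intro mult_mono) auto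
  then have G_bound: "\<bar>G v\<bar> \<le> D" for v
    by (cases v) (simp add: G_def)
  show ?thesis
  proof
    show "trig_poly h"
      unfolding h_def by (rule trig_poly_real_polynomial[OF p(1)])
    \<comment> \<open>Valid on the whole plane, since \<open>h\<close> sees \<open>G\<close> only at
      points of the torus; this controls the error outside the box.\<close>
    show "cmod (h z) \<le> D + e" for z
    proof -
      have "cmod (h z) \<le> cmod (h z - of_real (G (iexp (a * fst z), iexp (a * snd z))))
          + cmod (of_real (G (iexp (a * fst z), iexp (a * snd z))))"
        using norm_triangle_ineq by (metis diff_add_cancel)
      also have "\<dots> \<le> e + D"
        using near[of z] G_bound by (intro add_mono) auto
      finally show ?thesis by simp
    qed
    have Arg_eq: "Arg (iexp (a * x)) = a * x" and \<kappa>_eq: "\<kappa> (iexp (a * x)) = 1" if "\<bar>x\<bar> \<le> T" for x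
    proof -
      have "\<bar>a * x\<bar> \<le> a * T"
        using that \<open>a > 0\<close> by (simp add: abs_mult)
      also have "a * T = pi / 3"
        using \<open>0 < T\<close> by (simp add: a_def)
      finally have small: "\<bar>a * x\<bar> \<le> pi / 3" .
      then have "a * x \<in> {-pi<..pi}"
        using pi_gt_zero unfolding greaterThanAtMost_iff by linarith
      then show "Arg (iexp (a * x)) = a * x"
        using Arg_cis[of "a * x"] by (simp add: cis_conv_exp)
      have "cos (pi / 3) \<le> cos \<bar>a * x\<bar>"
        using small pi_gt_zero by (intro cos_monotone_0_pi_le) auto
      then show "\<kappa> (iexp (a * x)) = 1"
        by (simp add: \<kappa>_def Re_exp cos_60)
    qed
    show "cmod (h z - of_real (f z)) \<le> e" if "\<bar>fst z\<bar> \<le> T" "\<bar>snd z\<bar> \<le> T" for z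
      using near[of z] that Arg_eq \<kappa>_eq \<open>a > 0\<close> by (simp add: G_def)
  qed
qed

text \<open>Weak convergence tests continuous functions, so the indicator of a tail is replaced by
  the tent \<open>k T\<close>, which lies below the indicator of the interval from \<open>-T\<close>
  to \<open>T\<close>. Its integral under the limit law is close to 1 for large \<open>T\<close>,
  and for that fixed \<open>T\<close> this passes to the sequence.\<close>

lemma weak_conv_m_tight:
  assumes "\<And>n. real_distribution (\<mu> n)" "real_distribution M" "weak_conv_m \<mu> M" "0 < e"
  obtains T where "0 < T" "\<forall>\<^sub>F n in sequentially. measure (\<mu> n) {x. T < \<bar>x\<bar>} < e"
proof -
  interpret M: real_distribution M by fact
  define k :: "real \<Rightarrow> real \<Rightarrow> real" where "k T x = max 0 (1 - \<bar>x\<bar> / T)" for T x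
  have k_bounds: "0 \<le> k T x" "T > 0 \<Longrightarrow> k T x \<le> 1" for T x
    by (auto simp: k_def)
  have k_meas [measurable]: "k T \<in> borel_measurable borel" for T
    unfolding k_def by measurable
  have "(\<lambda>m. \<integral>x. k (real (Suc m)) x \<partial>M) \<longlonglongrightarrow> (\<integral>x. 1 \<partial>M)"
  proof (rule integral_dominated_convergence[where w="\<lambda>_. 1"])
    have "(\<lambda>m. max 0 (1 - \<bar>x\<bar> * inverse (real (Suc m)))) \<longlonglongrightarrow> max 0 (1 - \<bar>x\<bar> * 0)" for x :: real
      by (intro tendsto_intros LIMSEQ_inverse_real_of_nat)
    then show "AE x in M. (\<lambda>m. k (real (Suc m)) x) \<longlonglongrightarrow> 1"
      by (simp add: k_def divide_inverse)
    show "AE x in M. norm (k (real (Suc m)) x) \<le> 1" for m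
      using k_bounds(1)[of "real (Suc m)"] k_bounds(2)[of "real (Suc m)"] by auto
  qed auto
  then have "\<forall>\<^sub>F m in sequentially. 1 - e < (\<integral>x. k (real (Suc m)) x \<partial>M)"
    using \<open>0 < e\<close> by (intro order_tendstoD[where y="\<integral>x. 1 \<partial>M"]) (auto simp: M.prob_space simp del: M.space_eq_univ)
  then obtain m where m: "1 - e < (\<integral>x. k (real (Suc m)) x \<partial>M)"
    by (auto simp: eventually_sequentially)
  define T where "T = real (Suc m)"
  have "T > 0" by (simp add: T_def)
  have "(\<lambda>n. \<integral>x. k T x \<partial>\<mu> n) \<longlonglongrightarrow> (\<integral>x. k T x \<partial>M)"
  proof (rule weak_conv_imp_integral_bdd_continuous_conv[OF assms(1-3), where B=1])
    show "isCont (k T) x" for x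
      unfolding k_def using \<open>T > 0\<close> by (intro continuous_intros) auto
    show "norm (k T x) \<le> 1" for x
      using k_bounds[of T x] \<open>T > 0\<close> by simp
  qed
  then have "\<forall>\<^sub>F n in sequentially. 1 - e < (\<integral>x. k T x \<partial>\<mu> n)"
    using m by (intro order_tendstoD) (auto simp: T_def)
  then have "\<forall>\<^sub>F n in sequentially. measure (\<mu> n) {x. T < \<bar>x\<bar>} < e"
  proof eventually_elim
    case (elim n)
    interpret real_distribution "\<mu> n" by (rule assms)
    note sp = space_eq_univ
    have int: "integrable (\<mu> n) (k T)"
      using k_bounds \<open>T > 0\<close> by (intro integrable_const_bound[where B=1]) auto
    have "(\<integral>x. k T x \<partial>\<mu> n) \<le> (\<integral>x. 1 - indicator {x. T < \<bar>x\<bar>} x \<partial>\<mu> n)"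
    proof (rule integral_mono[OF int])
      show "integrable (\<mu> n) (\<lambda>x. 1 - indicator {x. T < \<bar>x\<bar>} x :: real)"
        by (intro integrable_const_bound[where B=1]) (auto split: split_indicator)
      show "k T x \<le> 1 - indicator {x. T < \<bar>x\<bar>} x" for x
        using \<open>T > 0\<close> k_bounds(2)[of T x] by (auto simp: k_def field_simps split: split_indicator)
    qed
    also have "\<dots> = 1 - measure (\<mu> n) {x. T < \<bar>x\<bar>}"
      by (subst Bochner_Integration.integral_diff)
         (auto simp: prob_space[unfolded sp] less_top[symmetric])
    finally show ?case
      using elim by simp
  qed
  with \<open>T > 0\<close> that show ?thesis by blast
qed

section \<open>From trigonometric polynomials to bounded continuous test functions\<close>

lemma integrable_iexp_prod:
  assumes "prob_space M" "sets M = sets (borel :: (real \<times> real) measure)"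
  shows "integrable M (\<lambda>z. iexp (s * fst z + t * snd z))"
proof -
  interpret prob_space M by fact
  have "(\<lambda>z. s * fst z + t * snd z) \<in> borel_measurable M"
    unfolding measurable_cong_sets[OF assms(2) refl]
    by (intro borel_measurable_continuous_onI continuous_intros)
  from measurable_compose[OF this borel_measurable_of_real] show ?thesis
    by (rule integrable_iexp) (rule Im_complex_of_real)
qed

lemma trig_poly_integral_tendsto:
  assumes "\<And>n. prob_space (M n)" "\<And>n. sets (M n) = sets (borel :: (real \<times> real) measure)"
    and "prob_space \<mu>" "sets \<mu> = sets (borel :: (real \<times> real) measure)"
    and "\<And>s t. (\<lambda>n. CLINT z|M n. iexp (s * fst z + t * snd z))
            \<longlonglongrightarrow> (CLINT z|\<mu>. iexp (s * fst z + t * snd z))"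
    and "trig_poly h"
  shows "(\<lambda>n. CLINT z|M n. h z) \<longlonglongrightarrow> (CLINT z|\<mu>. h z)"
    and "\<And>n. integrable (M n) h" and "integrable \<mu> h"
proof -
  have int_M: "integrable (M n) (\<lambda>z. iexp (s * fst z + t * snd z))" for n s t
    using assms by (intro integrable_iexp_prod)
  have int_\<mu>: "integrable \<mu> (\<lambda>z. iexp (s * fst z + t * snd z))" for s t
    using assms by (intro integrable_iexp_prod)
  have "(\<lambda>n. CLINT z|M n. h z) \<longlonglongrightarrow> (CLINT z|\<mu>. h z) \<and> (\<forall>n. integrable (M n) h) \<and> integrable \<mu> h"
    using assms(6)
  proof induction
    case (monom c s t)
    show ?case
      using int_M int_\<mu> assms(5)[of s t] by (auto intro!: tendsto_mult_left)
  next
    case (add f g)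
    then show ?case
      by (auto intro!: tendsto_add simp: Bochner_Integration.integral_add)
  qed
  then show "(\<lambda>n. CLINT z|M n. h z) \<longlonglongrightarrow> (CLINT z|\<mu>. h z)"
    and "\<And>n. integrable (M n) h" and "integrable \<mu> h"
    by auto
qed

text \<open>The complement of the box is covered by the tails of the two coordinates, so tightness
  of the marginals on the line suffices.\<close>

lemma integral_diff_le_outside_box:
  fixes f :: "real \<times> real \<Rightarrow> real"
  assumes "prob_space M" and [measurable_cong]: "sets M = sets (borel :: (real \<times> real) measure)"
    and "integrable M f" "integrable M h" "0 \<le> e" "0 \<le> D"
    and box: "\<And>z. \<bar>fst z\<bar> \<le> T \<Longrightarrow> \<bar>snd z\<bar> \<le> T \<Longrightarrow> cmod (h z - of_real (f z)) \<le> e"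
    and out: "\<And>z. cmod (h z - of_real (f z)) \<le> e + D"
  shows "cmod ((CLINT z|M. h z) - of_real (\<integral>z. f z \<partial>M))
    \<le> e + D * (measure M {z. T < \<bar>fst z\<bar>} + measure M {z. T < \<bar>snd z\<bar>})"
proof -
  interpret prob_space M by fact
  have sp: "space M = UNIV"
    using sets_eq_imp_space_eq[OF assms(2)] by simp
  have [measurable]: "{z. T < \<bar>fst z\<bar>} \<in> sets M" "{z. T < \<bar>snd z\<bar>} \<in> sets M"
    unfolding assms(2) by (auto intro!: borel_open open_Collect_less continuous_intros)
  let ?b = "\<lambda>z. e + D * (indicator {z. T < \<bar>fst z\<bar>} z + indicator {z. T < \<bar>snd z\<bar>} z) :: real"
  have "cmod ((CLINT z|M. h z) - of_real (\<integral>z. f z \<partial>M)) = cmod (CLINT z|M. h z - of_real (f z))"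
    using assms(3,4) by simp
  also have "\<dots> \<le> (\<integral>z. cmod (h z - of_real (f z)) \<partial>M)"
    by (rule integral_norm_bound)
  also have "\<dots> \<le> (\<integral>z. ?b z \<partial>M)"
  proof (rule integral_mono)
    show "integrable M (\<lambda>z. cmod (h z - of_real (f z)))"
      using assms(3,4) by auto
    show "integrable M ?b"
      by (auto simp: less_top[symmetric])
    show "cmod (h z - of_real (f z)) \<le> ?b z" for z
      using box[of z] out[of z] \<open>0 \<le> D\<close> by (auto split: split_indicator)
  qed
  also have "\<dots> = e + D * (measure M {z. T < \<bar>fst z\<bar>} + measure M {z. T < \<bar>snd z\<bar>})"
    by (simp add: less_top[symmetric] prob_space[unfolded sp] sp)
  finally show ?thesis .
qed

text \<open>Setting \<open>t = 0\<close> or \<open>s = 0\<close> gives the marginals, which are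
  tight by the one-dimensional theorem. Inside a large box a trigonometric polynomial replaces
  \<open>f\<close>, and its integrals converge by linearity.\<close>

theorem levy_continuity_prod:
  fixes f :: "real \<times> real \<Rightarrow> real"
  assumes M: "\<And>n. prob_space (M n)" and sets_M: "\<And>n. sets (M n) = sets (borel :: (real \<times> real) measure)"
    and \<mu>: "prob_space \<mu>" and sets_\<mu>: "sets \<mu> = sets (borel :: (real \<times> real) measure)"
    and char_lim: "\<And>s t. (\<lambda>n. CLINT z|M n. iexp (s * fst z + t * snd z))
            \<longlonglongrightarrow> (CLINT z|\<mu>. iexp (s * fst z + t * snd z))"
    and f: "continuous_on UNIV f" "bounded (range f)"
  shows "(\<lambda>n. \<integral>z. f z \<partial>M n) \<longlonglongrightarrow> (\<integral>z. f z \<partial>\<mu>)"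
proof -
  \<comment> \<open>Stated for an arbitrary sequence, so that the constant one yields the tail
    bounds of \<open>\<mu>\<close> itself.\<close>
  have tight: "\<exists>T>0. \<forall>\<^sub>F n in sequentially. measure (N n) {z. T < \<bar>\<pi> z\<bar>} < e"
    if "0 < e" and N: "\<And>n. prob_space (N n)" "\<And>n. sets (N n) = sets (borel :: (real \<times> real) measure)"
      and lim: "\<And>s t. (\<lambda>n. CLINT z|N n. iexp (s * fst z + t * snd z))
            \<longlonglongrightarrow> (CLINT z|\<mu>. iexp (s * fst z + t * snd z))"
      and \<pi>: "\<pi> = fst \<or> \<pi> = snd" for e N and \<pi> :: "real \<times> real \<Rightarrow> real"
  proof -
    have meas: "\<pi> \<in> borel_measurable K" if "sets K = sets (borel :: (real \<times> real) measure)" for K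
      using \<pi> by (auto simp: measurable_cong_sets[OF that refl] intro!: borel_measurable_continuous_onI continuous_intros)
    have rd: "real_distribution (distr K borel \<pi>)"
      if "prob_space K" "sets K = sets (borel :: (real \<times> real) measure)" for K
      using that meas by (intro prob_space.real_distribution_distr)
    have char_eq: "char (distr K borel \<pi>) t = (CLINT z|K. iexp (t * \<pi> z))"
      if "sets K = sets (borel :: (real \<times> real) measure)" for K t
      unfolding char_def using meas[OF that] by (subst integral_distr) auto
    have "(\<lambda>n. char (distr (N n) borel \<pi>) t) \<longlonglongrightarrow> char (distr \<mu> borel \<pi>) t" for t
      using \<pi> lim[of t 0] lim[of 0 t] by (auto simp: char_eq N sets_\<mu>)
    then have "weak_conv_m (\<lambda>n. distr (N n) borel \<pi>) (distr \<mu> borel \<pi>)"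
      by (intro levy_continuity rd N \<mu> sets_\<mu>)
    from weak_conv_m_tight[OF rd rd this \<open>0 < e\<close>] N \<mu> sets_\<mu>
    obtain T where T: "0 < T" "\<forall>\<^sub>F n in sequentially. measure (distr (N n) borel \<pi>) {x. T < \<bar>x\<bar>} < e"
      by metis
    have "measure (distr (N n) borel \<pi>) {x. T < \<bar>x\<bar>} = measure (N n) {z. T < \<bar>\<pi> z\<bar>}" for n
      using meas[OF N(2)] sets_eq_imp_space_eq[OF N(2)]
      by (subst measure_distr) (auto simp: vimage_def)
    with T show ?thesis by auto
  qed
  obtain D where D: "\<And>z. \<bar>f z\<bar> \<le> D"
    using f(2) by (auto simp: bounded_iff)
  then have "D \<ge> 0"
    using abs_ge_zero order_trans by blast
  have f_meas: "f \<in> borel_measurable borel"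
    using f(1) by (rule borel_measurable_continuous_onI)
  have f_int: "integrable N f" if "prob_space N" "sets N = sets borel" for N
  proof -
    interpret prob_space N by fact
    show ?thesis
      using D f_meas that(2) by (intro integrable_const_bound[where B=D]) (auto cong: measurable_cong_sets)
  qed
  have "\<forall>\<^sub>F n in sequentially. dist (\<integral>z. f z \<partial>M n) (\<integral>z. f z \<partial>\<mu>) < r" if "r > 0" for r
  proof -
    \<comment> \<open>Replacing \<open>f\<close> by \<open>h\<close> costs at most
      \<open>e + r / 8\<close>, hence \<open>3 * r / 8\<close>, under \<open>M n\<close> and again
      under \<open>\<mu>\<close>; the convergence for \<open>h\<close> costs less than
      \<open>r / 4\<close>. The summand 1 in \<open>2 * D + 1\<close> keeps the divisor positive
      when \<open>D = 0\<close>.\<close>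
    define e where "e = min 1 (r / 4)"
    define d where "d = r / (16 * (2 * D + 1))"
    have "e > 0" "e \<le> 1" "e \<le> r / 4" using \<open>r > 0\<close> by (auto simp: e_def)
    have "d > 0" using \<open>r > 0\<close> \<open>D \<ge> 0\<close> by (simp add: d_def)
    have dD: "(2 * D + 1) * (d + d) = r / 8"
    proof -
      have "K * (r / (16 * K) + r / (16 * K)) = r / 8" if "K > 0" for K :: real
        using that by (simp add: field_simps)
      from this[of "2 * D + 1"] show ?thesis
        using \<open>D \<ge> 0\<close> by (simp add: d_def)
    qed
    obtain T1 where T1: "T1 > 0" "\<forall>\<^sub>F n in sequentially. measure (M n) {z. T1 < \<bar>fst z\<bar>} < d"
      using tight[OF \<open>d > 0\<close> M sets_M char_lim, of fst] by auto
    obtain T2 where T2: "T2 > 0" "\<forall>\<^sub>F n in sequentially. measure (M n) {z. T2 < \<bar>snd z\<bar>} < d"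
      using tight[OF \<open>d > 0\<close> M sets_M char_lim, of snd] by auto
    obtain T3 where T3: "T3 > 0" "measure \<mu> {z. T3 < \<bar>fst z\<bar>} < d"
      using tight[of d "\<lambda>_. \<mu>" fst] \<open>d > 0\<close> \<mu> sets_\<mu> by auto
    obtain T4 where T4: "T4 > 0" "measure \<mu> {z. T4 < \<bar>snd z\<bar>} < d"
      using tight[of d "\<lambda>_. \<mu>" snd] \<open>d > 0\<close> \<mu> sets_\<mu> by auto
    define T where "T = max (max T1 T2) (max T3 T4)"
    have "T > 0" "T1 \<le> T" "T2 \<le> T" "T3 \<le> T" "T4 \<le> T" using T1 by (auto simp: T_def)
    have mono: "measure N {z. T < \<bar>\<pi> z\<bar>} \<le> measure N {z. T' < \<bar>\<pi> z\<bar>}"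
      if "prob_space N" "sets N = sets (borel :: (real \<times> real) measure)" "T' \<le> T" "\<pi> = fst \<or> \<pi> = snd"
      for N T' and \<pi> :: "real \<times> real \<Rightarrow> real"
    proof -
      interpret prob_space N by fact
      show ?thesis
        using that by (intro finite_measure_mono) (auto intro!: borel_open open_Collect_less continuous_intros)
    qed
    obtain h where h: "trig_poly h"
        "\<And>z. \<bar>fst z\<bar> \<le> T \<Longrightarrow> \<bar>snd z\<bar> \<le> T \<Longrightarrow> cmod (h z - of_real (f z)) \<le> e"
        "\<And>z. cmod (h z) \<le> D + e"
      using trig_poly_approx[OF f(1) D \<open>e > 0\<close> \<open>T > 0\<close>] by metis
    have out: "cmod (h z - of_real (f z)) \<le> e + (2 * D + 1)" for z
      using norm_triangle_ineq4[of "h z" "of_real (f z)"] h(3)[of z] D[of z] by simp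
    note h_lim = trig_poly_integral_tendsto[OF M sets_M \<mu> sets_\<mu> char_lim h(1)]
    have close: "cmod ((CLINT z|N. h z) - of_real (\<integral>z. f z \<partial>N)) \<le> e + r / 8"
      if N: "prob_space N" "sets N = sets (borel :: (real \<times> real) measure)" "integrable N h"
        and less: "measure N {z. T < \<bar>fst z\<bar>} < d" "measure N {z. T < \<bar>snd z\<bar>} < d" for N
    proof -
      have "cmod ((CLINT z|N. h z) - of_real (\<integral>z. f z \<partial>N))
          \<le> e + (2 * D + 1) * (measure N {z. T < \<bar>fst z\<bar>} + measure N {z. T < \<bar>snd z\<bar>})"
        using h(2) out \<open>e > 0\<close> \<open>D \<ge> 0\<close> N f_int[OF N(1,2)] by (intro integral_diff_le_outside_box) auto
      also have "\<dots> \<le> e + (2 * D + 1) * (d + d)"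
        using less \<open>D \<ge> 0\<close> by (intro add_left_mono mult_left_mono add_mono) auto
      finally show ?thesis unfolding dD .
    qed
    have close_\<mu>: "cmod ((CLINT z|\<mu>. h z) - of_real (\<integral>z. f z \<partial>\<mu>)) \<le> e + r / 8"
      using T3 T4 mono[OF \<mu> sets_\<mu>, of T3 fst] mono[OF \<mu> sets_\<mu>, of T4 snd] \<open>T3 \<le> T\<close> \<open>T4 \<le> T\<close>
      by (intro close \<mu> sets_\<mu> h_lim(3)) auto
    have "\<forall>\<^sub>F n in sequentially. dist (CLINT z|M n. h z) (CLINT z|\<mu>. h z) < r / 4"
      using h_lim(1) \<open>r > 0\<close> by (intro tendstoD) auto
    with T1(2) T2(2) show ?thesis
    proof eventually_elim
      case (elim n)
      have "cmod ((CLINT z|M n. h z) - of_real (\<integral>z. f z \<partial>M n)) \<le> e + r / 8"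
        using elim mono[OF M sets_M, of T1 fst n] mono[OF M sets_M, of T2 snd n] \<open>T1 \<le> T\<close> \<open>T2 \<le> T\<close>
        by (intro close M sets_M h_lim(2)) auto
      moreover have "dist b d \<le> cmod (a - b) + dist a c + cmod (c - d)" for a b c d :: complex
        using dist_triangle[of b d a] dist_triangle[of a d c] by (simp add: dist_norm norm_minus_commute)
      note this[of "complex_of_real (\<integral>z. f z \<partial>M n)" "of_real (\<integral>z. f z \<partial>\<mu>)"
          "CLINT z|M n. h z" "CLINT z|\<mu>. h z"]
      ultimately have "dist (complex_of_real (\<integral>z. f z \<partial>M n)) (of_real (\<integral>z. f z \<partial>\<mu>)) < r"
        using close_\<mu> elim(3) \<open>e \<le> r / 4\<close> \<open>r > 0\<close> by linarith
      then show ?case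
        by (simp only: dist_of_real)
    qed
  qed
  then show ?thesis
    by (rule tendstoI)
qed

text \<open>Uniqueness from continuity: along the constant sequence \<open>K\<close> the integrals
  are constant, so their limit under \<open>N\<close> is the same number.\<close>

corollary integral_eq_of_char_prod_eq:
  fixes F :: "real \<times> real \<Rightarrow> complex"
  assumes K: "prob_space K" "sets K = sets (borel :: (real \<times> real) measure)"
    and N: "prob_space N" "sets N = sets (borel :: (real \<times> real) measure)"
    and char_eq: "\<And>s t. (CLINT z|K. iexp (s * fst z + t * snd z)) = (CLINT z|N. iexp (s * fst z + t * snd z))"
    and F: "continuous_on UNIV F" "\<And>z. cmod (F z) \<le> B"
  shows "(CLINT z|K. F z) = (CLINT z|N. F z)"
proof -
  have real_eq: "(\<integral>z. f z \<partial>K) = (\<integral>z. f z \<partial>N)"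
    if "continuous_on UNIV f" "bounded (range f)" for f :: "real \<times> real \<Rightarrow> real"
    using levy_continuity_prod[of "\<lambda>_. K" N f] K N that char_eq by (simp add: LIMSEQ_const_iff)
  have int: "integrable L F" if "prob_space L" "sets L = sets (borel :: (real \<times> real) measure)" for L
  proof -
    interpret prob_space L by fact
    have "F \<in> borel_measurable L"
      unfolding measurable_cong_sets[OF that(2) refl] using F(1) by (rule borel_measurable_continuous_onI)
    then show ?thesis
      using F(2) by (intro integrable_const_bound[where B=B]) auto
  qed
  have "bounded (range (\<lambda>z. Re (F z)))" "bounded (range (\<lambda>z. Im (F z)))"
    using order_trans[OF abs_Re_le_cmod F(2)] order_trans[OF abs_Im_le_cmod F(2)]
    by (auto simp: bounded_iff)
  then have "(\<integral>z. Re (F z) \<partial>K) = (\<integral>z. Re (F z) \<partial>N)" "(\<integral>z. Im (F z) \<partial>K) = (\<integral>z. Im (F z) \<partial>N)"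
    using F(1) by (intro real_eq continuous_intros; simp)+
  then show ?thesis
    using int[OF K] int[OF N] by (simp add: complex_eq_iff)
qed

section \<open>Gaussian laws\<close>

lemma real_distribution_normal_law:
  assumes "0 \<le> v"
  shows "real_distribution (normal_law v)"
proof (cases "v = 0")
  case True
  then show ?thesis
    by (auto simp: normal_law_def real_distribution_def real_distribution_axioms_def
        intro!: prob_space_return)
next
  case False
  then show ?thesis
    using assms by (auto simp: normal_law_def real_distribution_def real_distribution_axioms_def
        intro!: prob_space_normal_density)
qed

lemma char_normal_law:
  assumes "0 \<le> v"
  shows "char (normal_law v) t = of_real (exp (- (v * t\<^sup>2) / 2))"
proof (cases "v = 0")
  case True
  then show ?thesis
    by (simp add: normal_law_def char_def integral_return)
next
  case False
  with assms have "v > 0" by simp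
  interpret N: real_distribution std_normal_distribution
    by (rule real_dist_normal_dist)
  have "distributed std_normal_distribution lborel (\<lambda>x. x) std_normal_density"
    by (auto simp: distributed_def distr_id2)
  from N.normal_density_affine[OF this, of "sqrt v" 0] \<open>v > 0\<close>
  have "distributed std_normal_distribution lborel (\<lambda>x. sqrt v * x) (normal_density 0 (sqrt v))"
    by simp
  then have "normal_law v = distr std_normal_distribution lborel (\<lambda>x. sqrt v * x)"
    using False by (simp add: normal_law_def distributed_def)
  also have "\<dots> = distr std_normal_distribution borel (\<lambda>x. sqrt v * x)"
    by (rule distr_cong) auto
  finally have "char (normal_law v) t = (CLINT x|std_normal_distribution. iexp (t * (sqrt v * x)))"
    unfolding char_def by (simp add: integral_distr)
  also have "\<dots> = char std_normal_distribution (t * sqrt v)"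
    by (simp add: char_def mult.assoc)
  finally show ?thesis
    using \<open>v > 0\<close> by (simp add: char_std_normal_distribution power_mult_distrib mult.commute)
qed

lemma normal_law_moments:
  assumes "0 < v"
  shows "integrable (normal_law v) (\<lambda>x. x ^ 2)" "integrable (normal_law v) (\<lambda>x. x ^ 4)"
    "(\<integral>x. x ^ 2 \<partial>normal_law v) = v" "(\<integral>x. x ^ 4 \<partial>normal_law v) = 3 * v\<^sup>2"
proof -
  have "has_bochner_integral lborel (\<lambda>x. normal_density 0 (sqrt v) x * x ^ 2) v"
    using normal_moment_even[of "sqrt v" 0 1] assms by simp
  moreover have "has_bochner_integral lborel (\<lambda>x. normal_density 0 (sqrt v) x * x ^ 4) (3 * v\<^sup>2)"
    using normal_moment_even[of "sqrt v" 0 2] assms by (simp add: fact_numeral field_simps)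
  ultimately show "integrable (normal_law v) (\<lambda>x. x ^ 2)" "integrable (normal_law v) (\<lambda>x. x ^ 4)"
    "(\<integral>x. x ^ 2 \<partial>normal_law v) = v" "(\<integral>x. x ^ 4 \<partial>normal_law v) = 3 * v\<^sup>2"
    using assms
    by (simp_all add: normal_law_def integrable_density integral_density has_bochner_integral_iff)
qed

section \<open>Products of two centred normal laws\<close>

context
  fixes v w :: real
  assumes vw: "0 \<le> v" "0 \<le> w"
begin

interpretation V: real_distribution "normal_law v"
  by (rule real_distribution_normal_law[OF vw(1)])

interpretation W: real_distribution "normal_law w"
  by (rule real_distribution_normal_law[OF vw(2)])

interpretation VW: pair_prob_space "normal_law v" "normal_law w" ..

lemma prob_space_normal_law_pair: "prob_space (normal_law v \<Otimes>\<^sub>M normal_law w)"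
  by unfold_locales

lemma sets_normal_law_pair: "sets (normal_law v \<Otimes>\<^sub>M normal_law w) = sets borel"
  unfolding borel_prod[symmetric] by (intro sets_pair_measure_cong V.events_eq_borel W.events_eq_borel)

lemma integral_normal_law_pair:
  fixes F :: "real \<times> real \<Rightarrow> complex"
  assumes "continuous_on UNIV F" "\<And>z. cmod (F z) \<le> B"
  shows "(CLINT z|normal_law v \<Otimes>\<^sub>M normal_law w. F z)
    = (CLINT x|normal_law v. CLINT y|normal_law w. F (x, y))"
proof -
  have "F \<in> borel_measurable (normal_law v \<Otimes>\<^sub>M normal_law w)"
    unfolding measurable_cong_sets[OF sets_normal_law_pair refl]
    using assms(1) by (rule borel_measurable_continuous_onI)
  then have "integrable (normal_law v \<Otimes>\<^sub>M normal_law w) F"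
    using assms(2) by (intro VW.integrable_const_bound[where B=B]) auto
  then show ?thesis
    by (rule VW.integral_fst'[symmetric])
qed

lemma integral_iexp_normal_law_pair:
  "(CLINT z|normal_law v \<Otimes>\<^sub>M normal_law w. iexp (s * fst z + t * snd z))
    = of_real (exp (- (v * s\<^sup>2 + w * t\<^sup>2) / 2))"
proof -
  have "(CLINT z|normal_law v \<Otimes>\<^sub>M normal_law w. iexp (s * fst z + t * snd z))
      = (CLINT x|normal_law v. CLINT y|normal_law w. iexp (s * fst (x, y) + t * snd (x, y)))"
    by (rule integral_normal_law_pair[where B=1])
       (auto intro!: continuous_intros simp del: of_real_add of_real_mult)
  also have "\<dots> = (CLINT x|normal_law v. CLINT y|normal_law w. iexp (s * x) * iexp (t * y))"
    by (simp add: exp_add distrib_left)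
  also have "\<dots> = char (normal_law v) s * char (normal_law w) t"
    unfolding char_def by simp
  finally show ?thesis
    using vw by (simp add: char_normal_law exp_add[symmetric] of_real_mult[symmetric] add_divide_distrib
        del: of_real_mult)
qed

end

text \<open>For a fixed value of \<open>X\<close> the exponent is linear in \<open>Y\<close> with
  slope \<open>\<beta> + \<theta> * X\<close>, so integrating out a normal \<open>Y\<close> leaves a
  Gaussian factor. Both sides are integrals of bounded continuous functions of the pair, so
  uniqueness permits the computation under the product law.\<close>

lemma (in prob_space) integral_iexp_bilinear:
  fixes X Y :: "'a \<Rightarrow> real"
  assumes vw: "0 \<le> v" "0 \<le> w"
    and meas: "(\<lambda>\<omega>. (X \<omega>, Y \<omega>)) \<in> borel_measurable M"
    and char_XY: "\<And>s t. (CLINT \<omega>|M. iexp (s * X \<omega> + t * Y \<omega>)) = of_real (exp (- (v * s\<^sup>2 + w * t\<^sup>2) / 2))"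
  shows "(CLINT \<omega>|M. iexp (\<alpha> * X \<omega> + \<beta> * Y \<omega> + \<theta> * (X \<omega> * Y \<omega>)))
    = (CLINT \<omega>|M. iexp (\<alpha> * X \<omega>) * of_real (exp (- (w * (\<beta> + \<theta> * X \<omega>)\<^sup>2) / 2)))"
proof -
  interpret W: real_distribution "normal_law w"
    by (rule real_distribution_normal_law[OF vw(2)])
  define K where "K = distr M borel (\<lambda>\<omega>. (X \<omega>, Y \<omega>))"
  define F where "F z = iexp (\<alpha> * fst z + \<beta> * snd z + \<theta> * (fst z * snd z))" for z :: "real \<times> real"
  define G where "G z = iexp (\<alpha> * fst z) * of_real (exp (- (w * (\<beta> + \<theta> * fst z)\<^sup>2) / 2))"
    for z :: "real \<times> real"
  have F_cont: "continuous_on UNIV F" and G_cont: "continuous_on UNIV G"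
    unfolding F_def G_def by (intro continuous_intros; simp)+
  have F_bound: "cmod (F z) \<le> 1" for z
    unfolding F_def by (simp del: of_real_add of_real_mult)
  have G_bound: "cmod (G z) \<le> 1" for z
    unfolding G_def using vw by (simp add: norm_mult del: of_real_mult)
  have K: "prob_space K" "sets K = sets borel"
    using meas by (auto simp: K_def intro: prob_space_distr)
  have K_int: "(CLINT z|K. H z) = (CLINT \<omega>|M. H (X \<omega>, Y \<omega>))" if "continuous_on UNIV H"
    for H :: "real \<times> real \<Rightarrow> complex"
    unfolding K_def using meas that by (intro integral_distr borel_measurable_continuous_onI)
  have "(CLINT z|K. iexp (s * fst z + t * snd z))
      = (CLINT z|normal_law v \<Otimes>\<^sub>M normal_law w. iexp (s * fst z + t * snd z))" for s t
    using char_XY[of s t] K_int[of "\<lambda>z. iexp (s * fst z + t * snd z)"]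
    by (simp add: integral_iexp_normal_law_pair[OF vw] continuous_intros del: of_real_add of_real_mult)
  note uniq = integral_eq_of_char_prod_eq[OF K prob_space_normal_law_pair[OF vw] sets_normal_law_pair[OF vw] this]
  have "(CLINT z|K. F z) = (CLINT x|normal_law v. CLINT y|normal_law w. F (x, y))"
    using uniq[OF F_cont F_bound] integral_normal_law_pair[OF vw F_cont F_bound] by simp
  also have "\<dots> = (CLINT x|normal_law v. CLINT y|normal_law w. iexp (\<alpha> * x) * iexp ((\<beta> + \<theta> * x) * y))"
    unfolding F_def exp_add[symmetric] by (simp add: algebra_simps)
  also have "\<dots> = (CLINT x|normal_law v. iexp (\<alpha> * x) * char (normal_law w) (\<beta> + \<theta> * x))"
    unfolding char_def by simp
  \<comment> \<open>\<open>G\<close> ignores its second argument; the dummy integral restores the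
    form to which uniqueness applies.\<close>
  also have "\<dots> = (CLINT x|normal_law v. CLINT y|normal_law w. G (x, y))"
    using vw W.prob_space by (simp add: char_normal_law G_def del: W.space_eq_univ)
  also have "\<dots> = (CLINT z|K. G z)"
    using uniq[OF G_cont G_bound] integral_normal_law_pair[OF vw G_cont G_bound] by simp
  finally show ?thesis
    by (simp add: K_int F_cont G_cont) (simp add: F_def G_def)
qed

text \<open>Cholesky factorisation: two independent standard normals are sent through a lower
  triangular matrix with entries \<open>a\<close>, \<open>b\<close>, \<open>c\<close>. The
  determinant condition makes \<open>c\<close> real; for \<open>v11 = 0\<close> it forces
  \<open>v12 = 0\<close>, in agreement with the value \<open>b = 0\<close> of the division by
  zero.\<close>

lemma gaussian2_exists:
  assumes "0 \<le> v11" "0 \<le> v22" "v12\<^sup>2 \<le> v11 * v22"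
  shows "\<exists>\<mu>. gaussian2 \<mu> v11 v12 v22"
proof -
  define a where "a = sqrt v11"
  define b where "b = v12 / sqrt v11"
  define c where "c = sqrt (v22 - b\<^sup>2)"
  have "b\<^sup>2 \<le> v22"
    using assms by (cases "v11 = 0") (auto simp: b_def power_divide field_simps)
  then have coeffs: "a\<^sup>2 = v11" "a * b = v12" "b\<^sup>2 + c\<^sup>2 = v22"
    using assms by (auto simp: a_def b_def c_def)
  define N where "N = normal_law 1 \<Otimes>\<^sub>M normal_law 1"
  interpret N: prob_space N
    unfolding N_def by (intro prob_space_normal_law_pair) auto
  have sets_N: "sets N = sets borel"
    unfolding N_def by (intro sets_normal_law_pair) auto
  have N_meas: "f \<in> borel_measurable N" if "continuous_on UNIV f" for f :: "real \<times> real \<Rightarrow> 'b::topological_space"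
    unfolding measurable_cong_sets[OF sets_N refl] using that by (rule borel_measurable_continuous_onI)
  define L where "L z = (a * fst z, b * fst z + c * snd z)" for z :: "real \<times> real"
  have L_meas: "L \<in> borel_measurable N"
    unfolding L_def by (intro N_meas continuous_intros)
  have "distr (distr N borel L) borel (\<lambda>(x, y). s * x + t * y)
      = normal_law (s\<^sup>2 * v11 + 2 * s * t * v12 + t\<^sup>2 * v22)" (is "_ = normal_law ?v") for s t
  proof -
    have v_eq: "?v = (s * a + t * b)\<^sup>2 + (t * c)\<^sup>2"
      unfolding coeffs[symmetric] by (simp add: power2_eq_square algebra_simps)
    have "distr (distr N borel L) borel (\<lambda>(x, y). s * x + t * y) = distr N borel ((\<lambda>(x, y). s * x + t * y) \<circ> L)"
      using L_meas by (intro distr_distr) (auto intro!: borel_measurable_continuous_onI continuous_intros simp: case_prod_beta)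
    also have "(\<lambda>(x, y). s * x + t * y) \<circ> L = (\<lambda>z. (s * a + t * b) * fst z + (t * c) * snd z)"
      by (auto simp: L_def algebra_simps)
    also have "distr N borel \<dots> = normal_law ?v"
    proof (rule Levy_uniqueness)
      have meas: "(\<lambda>z. (s * a + t * b) * fst z + (t * c) * snd z) \<in> borel_measurable N"
        by (intro N_meas continuous_intros)
      then show "real_distribution (distr N borel (\<lambda>z. (s * a + t * b) * fst z + (t * c) * snd z))"
        by (rule N.real_distribution_distr)
      show "real_distribution (normal_law ?v)"
        unfolding v_eq by (intro real_distribution_normal_law) auto
      have "char (distr N borel (\<lambda>z. (s * a + t * b) * fst z + (t * c) * snd z)) r = char (normal_law ?v) r" for r
      proof -
        have "char (distr N borel (\<lambda>z. (s * a + t * b) * fst z + (t * c) * snd z)) r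
            = (CLINT z|N. iexp ((r * (s * a + t * b)) * fst z + (r * (t * c)) * snd z))"
          unfolding char_def using meas by (subst integral_distr) (auto simp: algebra_simps)
        also have "\<dots> = of_real (exp (- (1 * (r * (s * a + t * b))\<^sup>2 + 1 * (r * (t * c))\<^sup>2) / 2))"
          unfolding N_def by (rule integral_iexp_normal_law_pair) auto
        also have "\<dots> = char (normal_law ?v) r"
        proof -
          have "1 * (r * (s * a + t * b))\<^sup>2 + 1 * (r * (t * c))\<^sup>2 = ((s * a + t * b)\<^sup>2 + (t * c)\<^sup>2) * r\<^sup>2"
            by (simp add: power2_eq_square algebra_simps)
          then show ?thesis
            unfolding v_eq by (subst char_normal_law) auto
        qed
        finally show ?thesis .
      qed
      then show "char (distr N borel (\<lambda>z. (s * a + t * b) * fst z + (t * c) * snd z)) = char (normal_law ?v)"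
        by auto
    qed
    finally show ?thesis .
  qed
  then have "gaussian2 (distr N borel L) v11 v12 v22"
    unfolding gaussian2_def using L_meas by (auto intro: N.prob_space_distr)
  then show ?thesis ..
qed

text \<open>The value at \<open>(s, t)\<close> is the characteristic function of the functional
  \<open>s * x + t * y\<close> at 1, whose law the definition prescribes.\<close>

lemma gaussian2_integral_iexp:
  assumes "gaussian2 \<mu> v11 v12 v22" and nonneg: "0 \<le> s\<^sup>2 * v11 + 2 * s * t * v12 + t\<^sup>2 * v22"
  shows "(CLINT z|\<mu>. iexp (s * fst z + t * snd z))
    = of_real (exp (- (s\<^sup>2 * v11 + 2 * s * t * v12 + t\<^sup>2 * v22) / 2))"
proof -
  have sets_\<mu>: "sets \<mu> = sets borel"
    and law: "distr \<mu> borel (\<lambda>z. s * fst z + t * snd z) = normal_law (s\<^sup>2 * v11 + 2 * s * t * v12 + t\<^sup>2 * v22)"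
    using assms(1) unfolding gaussian2_def case_prod_beta' by auto
  have "(\<lambda>z. s * fst z + t * snd z) \<in> borel_measurable \<mu>"
    unfolding measurable_cong_sets[OF sets_\<mu> refl]
    by (intro borel_measurable_continuous_onI continuous_intros)
  then have "(CLINT z|\<mu>. iexp (s * fst z + t * snd z)) = char (distr \<mu> borel (\<lambda>z. s * fst z + t * snd z)) 1"
    unfolding char_def by (subst integral_distr) auto
  then show ?thesis
    unfolding law using char_normal_law[OF nonneg, of 1] by simp
qed

section \<open>Convergence and boundedness in probability\<close>

context prob_space
begin

text \<open>Metric-valued, so that several statistics can be treated jointly as a tuple and passed
  through one continuous map.\<close>

definition tends_in_prob :: "(nat \<Rightarrow> 'a \<Rightarrow> 'b::metric_space) \<Rightarrow> 'b \<Rightarrow> bool" where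
  "tends_in_prob X c \<longleftrightarrow> (\<forall>e>0. (\<lambda>n. prob {\<omega> \<in> space M. e \<le> dist (X n \<omega>) c}) \<longlonglongrightarrow> 0)"

text \<open>Stochastic boundedness, usually written O_P(1). Finitely many indices are exempt because
  the bounds come from limit theorems.\<close>

definition bdd_in_prob :: "(nat \<Rightarrow> 'a \<Rightarrow> real) \<Rightarrow> bool" where
  "bdd_in_prob Y \<longleftrightarrow> (\<forall>e>0. \<exists>K>0. \<forall>\<^sub>F n in sequentially. prob {\<omega> \<in> space M. K < \<bar>Y n \<omega>\<bar>} < e)"

lemma prob_tendsto_0I:
  assumes "\<And>e. e > 0 \<Longrightarrow> \<forall>\<^sub>F n in sequentially. prob (S n) < e"
  shows "(\<lambda>n. prob (S n)) \<longlonglongrightarrow> 0"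
  by (rule tendstoI) (use assms in \<open>simp add: dist_real_def\<close>)

lemma tends_in_probD:
  "tends_in_prob X c \<Longrightarrow> d > 0 \<Longrightarrow> e > 0 \<Longrightarrow>
    \<forall>\<^sub>F n in sequentially. prob {\<omega> \<in> space M. d \<le> dist (X n \<omega>) c} < e"
  unfolding tends_in_prob_def by (rule order_tendstoD(2)) auto

lemma tends_in_prob_const:
  fixes c :: "'b :: metric_space"
  assumes "x \<longlonglongrightarrow> c"
  shows "tends_in_prob (\<lambda>n \<omega>. x n) c"
  unfolding tends_in_prob_def
proof (intro allI impI)
  fix e :: real assume "e > 0"
  have "\<forall>\<^sub>F n in sequentially. prob {\<omega> \<in> space M. e \<le> dist (x n) c} = 0"
    using tendstoD[OF assms \<open>e > 0\<close>] by eventually_elim simp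
  then show "(\<lambda>n. prob {\<omega> \<in> space M. e \<le> dist (x n) c}) \<longlonglongrightarrow> 0"
    by (rule tendsto_eventually)
qed

text \<open>Continuity at the limit point is enough, which allows coefficients with poles
  elsewhere.\<close>

lemma tends_in_prob_isCont:
  fixes X :: "nat \<Rightarrow> 'a \<Rightarrow> 'b :: {metric_space, second_countable_topology}"
    and h :: "'b \<Rightarrow> 'c :: metric_space"
  assumes [measurable]: "\<And>n. X n \<in> borel_measurable M"
    and X: "tends_in_prob X c" and "isCont h c"
  shows "tends_in_prob (\<lambda>n \<omega>. h (X n \<omega>)) (h c)"
  unfolding tends_in_prob_def
proof (intro allI impI)
  fix e :: real assume "e > 0"
  with \<open>isCont h c\<close> obtain d where d: "d > 0" "\<And>x. dist x c < d \<Longrightarrow> dist (h x) (h c) < e"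
    unfolding continuous_at_eps_delta by blast
  show "(\<lambda>n. prob {\<omega> \<in> space M. e \<le> dist (h (X n \<omega>)) (h c)}) \<longlonglongrightarrow> 0"
  proof (rule tendsto_sandwich[OF _ _ tendsto_const])
    show "(\<lambda>n. prob {\<omega> \<in> space M. d \<le> dist (X n \<omega>) c}) \<longlonglongrightarrow> 0"
      using X d(1) by (simp add: tends_in_prob_def)
    show "\<forall>\<^sub>F n in sequentially. prob {\<omega> \<in> space M. e \<le> dist (h (X n \<omega>)) (h c)}
        \<le> prob {\<omega> \<in> space M. d \<le> dist (X n \<omega>) c}"
      using d(2) by (intro always_eventually allI finite_measure_mono) (auto simp: not_less[symmetric])
  qed simp
qed

lemma tends_in_prob_Pair:
  fixes X :: "nat \<Rightarrow> 'a \<Rightarrow> 'b :: {metric_space, second_countable_topology}"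
    and Y :: "nat \<Rightarrow> 'a \<Rightarrow> 'c :: {metric_space, second_countable_topology}"
  assumes [measurable]: "\<And>n. X n \<in> borel_measurable M" "\<And>n. Y n \<in> borel_measurable M"
    and X: "tends_in_prob X c" and Y: "tends_in_prob Y d"
  shows "tends_in_prob (\<lambda>n \<omega>. (X n \<omega>, Y n \<omega>)) (c, d)"
  unfolding tends_in_prob_def
proof (intro allI impI)
  fix e :: real assume "e > 0"
  let ?A = "\<lambda>n. {\<omega> \<in> space M. e / 2 \<le> dist (X n \<omega>) c}"
  let ?B = "\<lambda>n. {\<omega> \<in> space M. e / 2 \<le> dist (Y n \<omega>) d}"
  show "(\<lambda>n. prob {\<omega> \<in> space M. e \<le> dist (X n \<omega>, Y n \<omega>) (c, d)}) \<longlonglongrightarrow> 0"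
  proof (rule tendsto_sandwich[OF _ _ tendsto_const])
    have "(\<lambda>n. prob (?A n) + prob (?B n)) \<longlonglongrightarrow> 0 + 0"
      using X[unfolded tends_in_prob_def, rule_format, of "e / 2"]
        Y[unfolded tends_in_prob_def, rule_format, of "e / 2"] \<open>e > 0\<close>
      by (intro tendsto_add) simp_all
    then show "(\<lambda>n. prob (?A n) + prob (?B n)) \<longlonglongrightarrow> 0"
      by simp
    have "prob {\<omega> \<in> space M. e \<le> dist (X n \<omega>, Y n \<omega>) (c, d)} \<le> prob (?A n) + prob (?B n)" for n
    proof -
      have "dist (X n \<omega>, Y n \<omega>) (c, d) \<le> dist (X n \<omega>) c + dist (Y n \<omega>) d" for \<omega>
        unfolding dist_Pair_Pair by (rule sqrt_sum_squares_le_sum) auto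
      from order_trans[OF _ this]
      have "e / 2 \<le> dist (X n \<omega>) c \<or> e / 2 \<le> dist (Y n \<omega>) d" if "e \<le> dist (X n \<omega>, Y n \<omega>) (c, d)" for \<omega>
        using that by fastforce
      then have "{\<omega> \<in> space M. e \<le> dist (X n \<omega>, Y n \<omega>) (c, d)} \<subseteq> ?A n \<union> ?B n"
        by blast
      then have "prob {\<omega> \<in> space M. e \<le> dist (X n \<omega>, Y n \<omega>) (c, d)} \<le> prob (?A n \<union> ?B n)"
        by (intro finite_measure_mono) auto
      also have "\<dots> \<le> prob (?A n) + prob (?B n)"
        by (intro measure_Un_le) auto
      finally show ?thesis .
    qed
    then show "\<forall>\<^sub>F n in sequentially. prob {\<omega> \<in> space M. e \<le> dist (X n \<omega>, Y n \<omega>) (c, d)}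
        \<le> prob (?A n) + prob (?B n)"
      by simp
  qed simp
qed

lemma tends_in_prob_0_add:
  fixes X Y :: "nat \<Rightarrow> 'a \<Rightarrow> real"
  assumes "\<And>n. X n \<in> borel_measurable M" "\<And>n. Y n \<in> borel_measurable M"
    and "tends_in_prob X 0" "tends_in_prob Y 0"
  shows "tends_in_prob (\<lambda>n \<omega>. X n \<omega> + Y n \<omega>) 0"
proof -
  have "isCont (\<lambda>z::real \<times> real. fst z + snd z) (0, 0)"
    by (intro continuous_intros)
  from tends_in_prob_isCont[OF _ tends_in_prob_Pair[OF assms] this] assms(1,2)
  show ?thesis by simp
qed

text \<open>Where \<open>\<bar>Y\<bar> \<le> K\<close>, a product of size \<open>d\<close> forces
  \<open>X\<close> to have size at least \<open>d / K\<close>.\<close>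

lemma tends_in_prob_0_mult_bdd:
  fixes X Y :: "nat \<Rightarrow> 'a \<Rightarrow> real"
  assumes [measurable]: "\<And>n. X n \<in> borel_measurable M" "\<And>n. Y n \<in> borel_measurable M"
    and X: "tends_in_prob X 0" and Y: "bdd_in_prob Y"
  shows "tends_in_prob (\<lambda>n \<omega>. X n \<omega> * Y n \<omega>) 0"
  unfolding tends_in_prob_def
proof (intro allI impI prob_tendsto_0I)
  fix d e :: real assume "d > 0" "e > 0"
  obtain K where K: "K > 0" "\<forall>\<^sub>F n in sequentially. prob {\<omega> \<in> space M. K < \<bar>Y n \<omega>\<bar>} < e / 2"
    using Y \<open>e > 0\<close> unfolding bdd_in_prob_def by (meson half_gt_zero)
  have "\<forall>\<^sub>F n in sequentially. prob {\<omega> \<in> space M. d / K \<le> dist (X n \<omega>) 0} < e / 2"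
    using X K(1) \<open>d > 0\<close> \<open>e > 0\<close> by (intro tends_in_probD) auto
  with K(2) show "\<forall>\<^sub>F n in sequentially. prob {\<omega> \<in> space M. d \<le> dist (X n \<omega> * Y n \<omega>) 0} < e"
  proof eventually_elim
    case (elim n)
    let ?A = "{\<omega> \<in> space M. d / K \<le> dist (X n \<omega>) 0}" and ?B = "{\<omega> \<in> space M. K < \<bar>Y n \<omega>\<bar>}"
    have "d / K \<le> \<bar>x\<bar>" if "d \<le> \<bar>x * y\<bar>" "\<bar>y\<bar> \<le> K" for x y
    proof -
      have "\<bar>x * y\<bar> \<le> \<bar>x\<bar> * K"
        unfolding abs_mult using that by (intro mult_left_mono) auto
      with that \<open>K > 0\<close> show ?thesis by (simp add: field_simps)
    qed
    then have "{\<omega> \<in> space M. d \<le> dist (X n \<omega> * Y n \<omega>) 0} \<subseteq> ?A \<union> ?B"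
      by (auto simp: not_less)
    then have "prob {\<omega> \<in> space M. d \<le> dist (X n \<omega> * Y n \<omega>) 0} \<le> prob (?A \<union> ?B)"
      by (intro finite_measure_mono) auto
    also have "\<dots> \<le> prob ?A + prob ?B"
      by (intro measure_Un_le) auto
    finally show ?case
      using elim by simp
  qed
qed

text \<open>Makes usable an algebraic identity that fails where a denominator vanishes, as long as
  those events become negligible.\<close>

lemma tends_in_prob_eq_on:
  fixes X Y :: "nat \<Rightarrow> 'a \<Rightarrow> real"
  assumes [measurable]: "\<And>n. X n \<in> borel_measurable M" "\<And>n. S n \<in> events"
    and X: "tends_in_prob X c" and S: "(\<lambda>n. prob (S n)) \<longlonglongrightarrow> 0"
    and eq: "\<forall>\<^sub>F n in sequentially. \<forall>\<omega> \<in> space M - S n. Y n \<omega> = X n \<omega>"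
  shows "tends_in_prob Y c"
  unfolding tends_in_prob_def
proof (intro allI impI prob_tendsto_0I)
  fix d e :: real assume "d > 0" "e > 0"
  have "\<forall>\<^sub>F n in sequentially. prob (S n) < e / 2"
    using S \<open>e > 0\<close> by (intro order_tendstoD(2)) auto
  moreover have "\<forall>\<^sub>F n in sequentially. prob {\<omega> \<in> space M. d \<le> dist (X n \<omega>) c} < e / 2"
    using X \<open>d > 0\<close> \<open>e > 0\<close> by (intro tends_in_probD) auto
  ultimately show "\<forall>\<^sub>F n in sequentially. prob {\<omega> \<in> space M. d \<le> dist (Y n \<omega>) c} < e"
    using eq
  proof eventually_elim
    case (elim n)
    have "prob {\<omega> \<in> space M. d \<le> dist (Y n \<omega>) c} \<le> prob (S n \<union> {\<omega> \<in> space M. d \<le> dist (X n \<omega>) c})"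
      using elim(3) by (intro finite_measure_mono) auto
    also have "\<dots> \<le> prob (S n) + prob {\<omega> \<in> space M. d \<le> dist (X n \<omega>) c}"
      by (intro measure_Un_le) auto
    finally show ?case
      using elim(1,2) by simp
  qed
qed

lemma tends_in_prob_0_expectation_norm:
  fixes X :: "nat \<Rightarrow> 'a \<Rightarrow> 'b :: {real_normed_vector, second_countable_topology}"
  assumes [measurable]: "\<And>n. X n \<in> borel_measurable M"
    and X: "tends_in_prob X 0" and bound: "\<And>n \<omega>. norm (X n \<omega>) \<le> B"
  shows "(\<lambda>n. expectation (\<lambda>\<omega>. norm (X n \<omega>))) \<longlonglongrightarrow> 0"
proof (rule tendstoI)
  fix e :: real assume "e > 0"
  have "B \<ge> 0"
    using norm_ge_zero bound by (rule order_trans)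
  \<comment> \<open>Dividing by \<open>B + 1\<close> covers \<open>B = 0\<close> and makes the final
    bound strict.\<close>
  have "\<forall>\<^sub>F n in sequentially. prob {\<omega> \<in> space M. e / 2 \<le> dist (X n \<omega>) 0} < e / (2 * (B + 1))"
    using X \<open>e > 0\<close> \<open>B \<ge> 0\<close> by (intro tends_in_probD) auto
  then show "\<forall>\<^sub>F n in sequentially. dist (expectation (\<lambda>\<omega>. norm (X n \<omega>))) 0 < e"
  proof eventually_elim
    case (elim n)
    let ?A = "{\<omega> \<in> space M. e / 2 \<le> dist (X n \<omega>) 0}"
    have "expectation (\<lambda>\<omega>. norm (X n \<omega>)) \<le> expectation (\<lambda>\<omega>. e / 2 + B * indicator ?A \<omega>)"
    proof (rule integral_mono)
      show "integrable M (\<lambda>\<omega>. norm (X n \<omega>))"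
        using bound by (intro integrable_const_bound[where B=B]) auto
      show "integrable M (\<lambda>\<omega>. e / 2 + B * indicator ?A \<omega>)"
        by (auto simp: less_top[symmetric])
      show "norm (X n \<omega>) \<le> e / 2 + B * indicator ?A \<omega>" if "\<omega> \<in> space M" for \<omega>
        using bound[of n \<omega>] that \<open>e > 0\<close> by (auto split: split_indicator)
    qed
    also have "\<dots> = e / 2 + B * prob ?A"
      by (simp add: less_top[symmetric] prob_space)
    also have "\<dots> \<le> e / 2 + B * (e / (2 * (B + 1)))"
      using elim \<open>B \<ge> 0\<close> by (intro add_left_mono mult_left_mono) auto
    also have "\<dots> < e"
      using \<open>B \<ge> 0\<close> \<open>e > 0\<close> by (simp add: field_simps)
    finally show ?case
      by (simp add: integral_nonneg_AE)
  qed
qed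

text \<open>The exponentials have modulus 1, so their distance is that of
  \<open>iexp (X - Y)\<close> from 1: bounded by 2 and a continuous function of the
  difference.\<close>

lemma integral_iexp_diff_tendsto_0:
  fixes X Y :: "nat \<Rightarrow> 'a \<Rightarrow> real"
  assumes X [measurable]: "\<And>n. X n \<in> borel_measurable M" and Y [measurable]: "\<And>n. Y n \<in> borel_measurable M"
    and diff: "tends_in_prob (\<lambda>n \<omega>. X n \<omega> - Y n \<omega>) 0"
  shows "(\<lambda>n. (CLINT \<omega>|M. iexp (X n \<omega>)) - (CLINT \<omega>|M. iexp (Y n \<omega>))) \<longlonglongrightarrow> 0"
proof (rule Lim_null_comparison)
  let ?W = "\<lambda>n \<omega>. iexp (X n \<omega> - Y n \<omega>) - 1"
  have "tends_in_prob ?W (iexp 0 - 1)"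
    by (rule tends_in_prob_isCont[OF _ diff, where h="\<lambda>x. iexp x - 1"]) (auto intro!: continuous_intros)
  moreover have "norm (?W n \<omega>) \<le> 2" for n \<omega>
    using norm_triangle_ineq4[of "iexp (X n \<omega> - Y n \<omega>)" 1] by (simp del: of_real_diff)
  ultimately show "(\<lambda>n. expectation (\<lambda>\<omega>. norm (?W n \<omega>))) \<longlonglongrightarrow> 0"
    by (intro tends_in_prob_0_expectation_norm[where B=2]) auto
  have "norm ((CLINT \<omega>|M. iexp (X n \<omega>)) - (CLINT \<omega>|M. iexp (Y n \<omega>)))
      \<le> expectation (\<lambda>\<omega>. norm (?W n \<omega>))" for n
  proof -
    have "(CLINT \<omega>|M. iexp (X n \<omega>)) - (CLINT \<omega>|M. iexp (Y n \<omega>)) = (CLINT \<omega>|M. iexp (X n \<omega>) - iexp (Y n \<omega>))"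
      by (intro Bochner_Integration.integral_diff[symmetric] integrable_iexp) auto
    also have "norm \<dots> \<le> expectation (\<lambda>\<omega>. norm (iexp (X n \<omega>) - iexp (Y n \<omega>)))"
      by (rule integral_norm_bound)
    also have "\<dots> = expectation (\<lambda>\<omega>. norm (?W n \<omega>))"
    proof (intro Bochner_Integration.integral_cong refl)
      fix \<omega>
      have "iexp (X n \<omega>) - iexp (Y n \<omega>) = iexp (Y n \<omega>) * ?W n \<omega>"
        by (simp add: algebra_simps exp_add[symmetric])
      then show "norm (iexp (X n \<omega>) - iexp (Y n \<omega>)) = norm (?W n \<omega>)"
        by (simp add: norm_mult)
    qed
    finally show ?thesis .
  qed
  then show "\<forall>\<^sub>F n in sequentially. norm ((CLINT \<omega>|M. iexp (X n \<omega>)) - (CLINT \<omega>|M. iexp (Y n \<omega>)))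
      \<le> expectation (\<lambda>\<omega>. norm (?W n \<omega>))"
    by simp
qed

lemma bdd_in_prob_weak_conv:
  assumes [measurable]: "\<And>n. Y n \<in> borel_measurable M"
    and "weak_conv_m (\<lambda>n. distr M borel (Y n)) N" "real_distribution N"
  shows "bdd_in_prob Y"
  unfolding bdd_in_prob_def
proof (intro allI impI)
  fix e :: real assume "e > 0"
  have rd: "real_distribution (distr M borel (Y n))" for n
    by simp
  obtain T where T: "T > 0" "\<forall>\<^sub>F n in sequentially. measure (distr M borel (Y n)) {x. T < \<bar>x\<bar>} < e"
    using weak_conv_m_tight[OF rd assms(3,2) \<open>e > 0\<close>] by metis
  have "measure (distr M borel (Y n)) {x. T < \<bar>x\<bar>} = prob {\<omega> \<in> space M. T < \<bar>Y n \<omega>\<bar>}" for n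
    by (subst measure_distr) (auto intro!: arg_cong[where f=prob])
  with T show "\<exists>K>0. \<forall>\<^sub>F n in sequentially. prob {\<omega> \<in> space M. K < \<bar>Y n \<omega>\<bar>} < e"
    by auto
qed

lemma bdd_in_prob_normal_limit:
  assumes [measurable]: "\<And>n. Y n \<in> borel_measurable M" and "0 \<le> v"
    and lim: "\<And>t. (\<lambda>n. CLINT \<omega>|M. iexp (t * Y n \<omega>)) \<longlonglongrightarrow> of_real (exp (- (v * t\<^sup>2) / 2))"
  shows "bdd_in_prob Y"
proof (rule bdd_in_prob_weak_conv)
  have "char (distr M borel (Y n)) t = (CLINT \<omega>|M. iexp (t * Y n \<omega>))" for n t
    unfolding char_def by (subst integral_distr) auto
  then show "weak_conv_m (\<lambda>n. distr M borel (Y n)) (normal_law v)"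
    using lim \<open>0 \<le> v\<close> by (intro levy_continuity real_distribution_normal_law) (auto simp: char_normal_law)
  show "real_distribution (normal_law v)"
    using \<open>0 \<le> v\<close> by (rule real_distribution_normal_law)
qed simp

end

section \<open>Quadratic statistics of a Gaussian error array\<close>

lemma iexp_sum: "finite I \<Longrightarrow> iexp (\<Sum>j\<in>I. x j) = (\<Prod>j\<in>I. iexp (x j))"
  by (simp add: exp_sum sum_distrib_left)

text \<open>\<open>char_EF\<close> states at once that \<open>E j\<close> and \<open>F j\<close> are
  independent and centred normal with variances \<open>v\<close> and \<open>w\<close>. The weights
  form a triangular array, whereas the errors form a single sequence.\<close>

locale gaussian_error_array = prob_space M for M :: "'a measure" +
  fixes E F :: "nat \<Rightarrow> 'a \<Rightarrow> real" and Z :: "nat \<Rightarrow> nat \<Rightarrow> real" and v w q :: real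
  assumes indep: "indep_vars (\<lambda>_. borel) (\<lambda>j \<omega>. (E j \<omega>, F j \<omega>)) UNIV"
    and char_EF: "\<And>j s t. (CLINT \<omega>|M. iexp (s * E j \<omega> + t * F j \<omega>)) = of_real (exp (- (v * s\<^sup>2 + w * t\<^sup>2) / 2))"
    and v_pos: "0 < v" and w_nonneg: "0 \<le> w"
    and Z_lim: "(\<lambda>n. (\<Sum>j<n. (Z n j)\<^sup>2) / n) \<longlonglongrightarrow> q"
begin

text \<open>Sums that settle to a constant are divided by \<open>n\<close>, those that stay random
  in the limit by \<open>sqrt n\<close>.\<close>

definition zz :: "nat \<Rightarrow> real" where "zz n = (\<Sum>j<n. (Z n j)\<^sup>2) / n"
definition ze :: "nat \<Rightarrow> 'a \<Rightarrow> real" where "ze n \<omega> = (\<Sum>j<n. Z n j * E j \<omega>) / sqrt n"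
definition zf :: "nat \<Rightarrow> 'a \<Rightarrow> real" where "zf n \<omega> = (\<Sum>j<n. Z n j * F j \<omega>) / sqrt n"
definition ef :: "nat \<Rightarrow> 'a \<Rightarrow> real" where "ef n \<omega> = (\<Sum>j<n. E j \<omega> * F j \<omega>) / sqrt n"
definition ee :: "nat \<Rightarrow> 'a \<Rightarrow> real" where "ee n \<omega> = (\<Sum>j<n. (E j \<omega>)\<^sup>2) / n"

lemma EF_measurable: "(\<lambda>\<omega>. (E j \<omega>, F j \<omega>)) \<in> borel_measurable M"
  using indep by (simp add: indep_vars_def2)

lemma E_measurable [measurable]: "E j \<in> borel_measurable M"
  using measurable_compose[OF EF_measurable, of fst borel j]
  by (simp add: borel_measurable_continuous_onI continuous_on_fst)

lemma F_measurable [measurable]: "F j \<in> borel_measurable M"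
  using measurable_compose[OF EF_measurable, of snd borel j]
  by (simp add: borel_measurable_continuous_onI continuous_on_snd)

lemma statistics_measurable [measurable]:
  "ze n \<in> borel_measurable M" "zf n \<in> borel_measurable M" "ef n \<in> borel_measurable M" "ee n \<in> borel_measurable M"
  unfolding ze_def[abs_def] zf_def[abs_def] ef_def[abs_def] ee_def[abs_def] by measurable

lemma zz_tendsto: "zz \<longlonglongrightarrow> q"
  using Z_lim unfolding zz_def[abs_def] .

lemma q_nonneg: "0 \<le> q"
  using Z_lim by (rule LIMSEQ_le_const) (auto intro!: exI[of _ 0] divide_nonneg_nonneg sum_nonneg)

lemma distr_E: "distr M borel (E j) = normal_law v"
proof (rule Levy_uniqueness)
  show "real_distribution (distr M borel (E j))" "real_distribution (normal_law v)"
    using v_pos by (auto intro: real_distribution_normal_law)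
  have "char (distr M borel (E j)) t = char (normal_law v) t" for t
    using char_EF[of t j 0] v_pos by (simp add: char_def[of "distr M borel (E j)"] integral_distr char_normal_law)
  then show "char (distr M borel (E j)) = char (normal_law v)" ..
qed

section \<open>Exact characteristic functions at finite sample size\<close>

lemma integral_prod_indep:
  fixes G :: "nat \<Rightarrow> real \<times> real \<Rightarrow> complex"
  assumes "\<And>j. continuous_on UNIV (G j)" "\<And>j z. cmod (G j z) \<le> 1"
  shows "(CLINT \<omega>|M. \<Prod>j<n. G j (E j \<omega>, F j \<omega>)) = (\<Prod>j<n. CLINT \<omega>|M. G j (E j \<omega>, F j \<omega>))"
proof (rule indep_vars_lebesgue_integral)
  have meas: "G j \<in> borel_measurable borel" for j
    using assms(1) by (rule borel_measurable_continuous_onI)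
  then show "indep_vars (\<lambda>_. borel) (\<lambda>j \<omega>. G j (E j \<omega>, F j \<omega>)) {..<n}"
    by (intro indep_vars_compose2[OF indep_vars_subset[OF indep]]) auto
  show "integrable M (\<lambda>\<omega>. G j (E j \<omega>, F j \<omega>))" for j
    using assms(2) measurable_compose[OF EF_measurable meas]
    by (intro integrable_const_bound[where B=1]) auto
qed simp

text \<open>Up to the factor \<open>w\<close> this is the conditional variance of
  \<open>b * zf + c * ef\<close> given the first errors. The form as a sum of squares shows it
  nonnegative, which later bounds the Gaussian factor by 1.\<close>

lemma sum_sq_decomp:
  "(\<Sum>j<n. (b * Z n j / sqrt n + c / sqrt n * E j \<omega>)\<^sup>2)
    = b\<^sup>2 * zz n + 2 * b * c * (ze n \<omega> / sqrt n) + c\<^sup>2 * ee n \<omega>"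
proof -
  have "(b * Z n j / sqrt n + c / sqrt n * E j \<omega>)\<^sup>2
      = b\<^sup>2 * ((Z n j)\<^sup>2 / n) + 2 * b * c * (Z n j * E j \<omega> / n) + c\<^sup>2 * ((E j \<omega>)\<^sup>2 / n)" for j
  proof -
    have "(x / sqrt n + y / sqrt n)\<^sup>2 = (x\<^sup>2 + 2 * x * y + y\<^sup>2) / n" for x y
      by (simp add: add_divide_distrib[symmetric] power_divide power2_sum)
    from this[of "b * Z n j" "c * E j \<omega>"] show ?thesis
      by (simp add: power_mult_distrib add_divide_distrib algebra_simps)
  qed
  moreover have "ze n \<omega> / sqrt n = (\<Sum>j<n. Z n j * E j \<omega>) / n"
    by (simp add: ze_def)
  ultimately show ?thesis
    by (simp add: sum.distrib sum_distrib_left sum_divide_distrib zz_def ee_def)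
qed

text \<open>Conditioning is done one index at a time: independence over \<open>j\<close> splits the
  expectation into integrals over single pairs, \<open>F j\<close> is integrated out of each, and
  independence read backwards reassembles one expectation over the first errors.\<close>

lemma integral_iexp_statistics:
  "(CLINT \<omega>|M. iexp (a * ze n \<omega> + b * zf n \<omega> + c * ef n \<omega>))
    = (CLINT \<omega>|M. iexp (a * ze n \<omega>)
        * of_real (exp (- (w * (b\<^sup>2 * zz n + 2 * b * c * (ze n \<omega> / sqrt n) + c\<^sup>2 * ee n \<omega>)) / 2)))"
proof -
  define \<alpha> where "\<alpha> j = a * Z n j / sqrt n" for j
  define \<beta> where "\<beta> j = b * Z n j / sqrt n" for j
  define \<theta> where "\<theta> = c / sqrt n"
  define G where "G j z = iexp (\<alpha> j * fst z + \<beta> j * snd z + \<theta> * (fst z * snd z))" for j and z :: "real \<times> real"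
  define H where "H j z = iexp (\<alpha> j * fst z) * of_real (exp (- (w * (\<beta> j + \<theta> * fst z)\<^sup>2) / 2))"
    for j and z :: "real \<times> real"
  have G: "continuous_on UNIV (G j)" "cmod (G j z) \<le> 1" for j z
    unfolding G_def by (auto intro!: continuous_intros simp del: of_real_add of_real_mult)
  have H: "continuous_on UNIV (H j)" "cmod (H j z) \<le> 1" for j z
    unfolding H_def using w_nonneg
    by (auto intro!: continuous_intros simp: norm_mult simp del: of_real_mult)
  have "a * ze n \<omega> + b * zf n \<omega> + c * ef n \<omega>
      = (\<Sum>j<n. \<alpha> j * E j \<omega> + \<beta> j * F j \<omega> + \<theta> * (E j \<omega> * F j \<omega>))" for \<omega>
    by (simp add: ze_def zf_def ef_def \<alpha>_def \<beta>_def \<theta>_def sum.distrib sum_distrib_left sum_divide_distrib mult.assoc)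
  then have "(CLINT \<omega>|M. iexp (a * ze n \<omega> + b * zf n \<omega> + c * ef n \<omega>))
      = (CLINT \<omega>|M. \<Prod>j<n. G j (E j \<omega>, F j \<omega>))"
    unfolding G_def by (simp only: iexp_sum[OF finite_lessThan] fst_conv snd_conv)
  also have "\<dots> = (\<Prod>j<n. CLINT \<omega>|M. G j (E j \<omega>, F j \<omega>))"
    using G by (rule integral_prod_indep)
  also have "\<dots> = (\<Prod>j<n. CLINT \<omega>|M. H j (E j \<omega>, F j \<omega>))"
    unfolding G_def H_def fst_conv snd_conv
    by (intro prod.cong refl integral_iexp_bilinear[OF less_imp_le[OF v_pos] w_nonneg EF_measurable char_EF])
  also have "\<dots> = (CLINT \<omega>|M. \<Prod>j<n. H j (E j \<omega>, F j \<omega>))"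
    using H by (rule integral_prod_indep[symmetric])
  also have "(\<lambda>\<omega>. \<Prod>j<n. H j (E j \<omega>, F j \<omega>)) = (\<lambda>\<omega>. iexp (a * ze n \<omega>)
        * of_real (exp (- (w * (b\<^sup>2 * zz n + 2 * b * c * (ze n \<omega> / sqrt n) + c\<^sup>2 * ee n \<omega>)) / 2)))"
  proof
    fix \<omega>
    have "(\<Prod>j<n. H j (E j \<omega>, F j \<omega>))
        = iexp (\<Sum>j<n. \<alpha> j * E j \<omega>) * of_real (exp (\<Sum>j<n. - (w * (\<beta> j + \<theta> * E j \<omega>)\<^sup>2) / 2))"
      unfolding H_def prod.distrib iexp_sum[OF finite_lessThan] exp_sum[OF finite_lessThan] of_real_prod by simp
    also have "(\<Sum>j<n. \<alpha> j * E j \<omega>) = a * ze n \<omega>"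
      by (simp add: ze_def \<alpha>_def sum_distrib_left sum_divide_distrib mult.assoc)
    also have "(\<Sum>j<n. - (w * (\<beta> j + \<theta> * E j \<omega>)\<^sup>2) / 2) = - (w * (\<Sum>j<n. (\<beta> j + \<theta> * E j \<omega>)\<^sup>2)) / 2"
      by (simp add: sum_distrib_left sum_negf sum_divide_distrib)
    finally show "(\<Prod>j<n. H j (E j \<omega>, F j \<omega>)) = iexp (a * ze n \<omega>)
        * of_real (exp (- (w * (b\<^sup>2 * zz n + 2 * b * c * (ze n \<omega> / sqrt n) + c\<^sup>2 * ee n \<omega>)) / 2))"
      unfolding \<beta>_def \<theta>_def sum_sq_decomp .
  qed
  finally show ?thesis .
qed

lemma integral_iexp_ze:
  "(CLINT \<omega>|M. iexp (t * ze n \<omega>)) = of_real (exp (- (v * zz n * t\<^sup>2) / 2))"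
proof -
  define \<alpha> where "\<alpha> j = t * Z n j / sqrt n" for j
  \<comment> \<open>The term \<open>0 * snd z\<close> keeps the shape of \<open>char_EF\<close>,
    used here with second argument 0.\<close>
  define G where "G j z = iexp (\<alpha> j * fst z + 0 * snd z)" for j and z :: "real \<times> real"
  have G: "continuous_on UNIV (G j)" "cmod (G j z) \<le> 1" for j z
    unfolding G_def by (auto intro!: continuous_intros simp del: of_real_add of_real_mult)
  have "t * ze n \<omega> = (\<Sum>j<n. \<alpha> j * E j \<omega> + 0 * F j \<omega>)" for \<omega>
    by (simp add: ze_def \<alpha>_def sum_distrib_left sum_divide_distrib mult.assoc)
  then have "(CLINT \<omega>|M. iexp (t * ze n \<omega>)) = (CLINT \<omega>|M. \<Prod>j<n. G j (E j \<omega>, F j \<omega>))"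
    unfolding G_def by (simp only: iexp_sum[OF finite_lessThan] fst_conv snd_conv)
  also have "\<dots> = (\<Prod>j<n. CLINT \<omega>|M. G j (E j \<omega>, F j \<omega>))"
    using G by (rule integral_prod_indep)
  also have "\<dots> = (\<Prod>j<n. of_real (exp (- (v * (\<alpha> j)\<^sup>2 + w * 0\<^sup>2) / 2)))"
    unfolding G_def fst_conv snd_conv char_EF ..
  also have "\<dots> = of_real (exp (\<Sum>j<n. - (v * (\<alpha> j)\<^sup>2 + w * 0\<^sup>2) / 2))"
    unfolding exp_sum[OF finite_lessThan] of_real_prod ..
  also have "(\<Sum>j<n. - (v * (\<alpha> j)\<^sup>2 + w * 0\<^sup>2) / 2) = - (v * zz n * t\<^sup>2) / 2"
    by (simp add: \<alpha>_def zz_def power_divide power_mult_distrib sum_negf sum_divide_distrib sum_distrib_left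
        sum_distrib_right mult_ac)
  finally show ?thesis .
qed

section \<open>Limits and bounds in probability for the normalised sums\<close>

lemma bdd_ze: "bdd_in_prob ze"
proof (rule bdd_in_prob_normal_limit)
  show "0 \<le> v * q"
    using v_pos q_nonneg by simp
  show "(\<lambda>n. CLINT \<omega>|M. iexp (t * ze n \<omega>)) \<longlonglongrightarrow> of_real (exp (- (v * q * t\<^sup>2) / 2))" for t
    unfolding integral_iexp_ze by (intro tendsto_intros zz_tendsto) simp
qed simp

lemma inverse_sqrt_tendsto_0: "(\<lambda>n. 1 / sqrt (real n)) \<longlonglongrightarrow> 0"
  by (intro tendsto_divide_0[OF tendsto_const] filterlim_at_top_imp_at_infinity
      filterlim_compose[OF sqrt_at_top filterlim_real_sequentially])

lemma ze_div_tendsto_0: "tends_in_prob (\<lambda>n \<omega>. ze n \<omega> / sqrt n) 0"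
proof -
  have "tends_in_prob (\<lambda>n \<omega>. 1 / sqrt (real n) * ze n \<omega>) 0"
    by (intro tends_in_prob_0_mult_bdd tends_in_prob_const inverse_sqrt_tendsto_0 bdd_ze) auto
  then show ?thesis by simp
qed

text \<open>The central limit theorem is used here only for the tightness of the centred and
  rescaled sums of squares, which gives the law of large numbers after dividing by \<open>sqrt n\<close>.\<close>

lemma ee_tendsto: "tends_in_prob ee v"
proof -
  define X where "X j \<omega> = (E j \<omega>)\<^sup>2 - v" for j \<omega>
  have moments: "integrable M (\<lambda>\<omega>. (E j \<omega>) ^ 2)" "integrable M (\<lambda>\<omega>. (E j \<omega>) ^ 4)"
    "expectation (\<lambda>\<omega>. (E j \<omega>) ^ 2) = v" "expectation (\<lambda>\<omega>. (E j \<omega>) ^ 4) = 3 * v\<^sup>2" for j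
    using normal_law_moments[OF v_pos] unfolding distr_E[of j, symmetric]
    by (simp_all add: integrable_distr_eq integral_distr)
  have X_meas [measurable]: "X j \<in> borel_measurable M" for j
    unfolding X_def[abs_def] by measurable
  have X_mean: "expectation (X j) = 0" for j
    using moments[of j] by (simp add: X_def[abs_def] prob_space)
  have X_sq: "(X j \<omega>)\<^sup>2 = (E j \<omega>) ^ 4 - 2 * v * (E j \<omega>)\<^sup>2 + v\<^sup>2" for j \<omega>
    by (simp add: X_def power2_eq_square power4_eq_xxxx algebra_simps)
  have sq_int: "integrable M (\<lambda>\<omega>. (X j \<omega>)\<^sup>2)" for j
    unfolding X_sq using moments[of j] by simp
  \<comment> \<open>The moments give \<open>3 * v^2 - 2 * v * v + v^2 = 2 * v^2\<close>, written as
    the square of the standard deviation that the central limit theorem asks for.\<close>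
  have "expectation (\<lambda>\<omega>. (X j \<omega>)\<^sup>2) = (sqrt 2 * v)\<^sup>2" for j
    unfolding X_sq using moments[of j] by (simp add: prob_space power_mult_distrib power2_eq_square)
  then have var: "variance (X j) = (sqrt 2 * v)\<^sup>2" for j
    by (simp add: X_mean)
  have X_indep: "indep_vars (\<lambda>_. borel) X UNIV"
    using indep_vars_compose2[OF indep, of "\<lambda>j z. (fst z)\<^sup>2 - v" "\<lambda>_. borel"]
    by (simp add: X_def[abs_def] borel_measurable_continuous_onI continuous_intros)
  have X_distr: "distr M borel (X j) = distr (normal_law v) borel (\<lambda>x. x\<^sup>2 - v)" for j
    unfolding distr_E[of j, symmetric] by (subst distr_distr) (auto simp: comp_def X_def[abs_def])
  have "weak_conv_m (\<lambda>n. distr M borel (\<lambda>\<omega>. (\<Sum>j<n. X j \<omega>) / sqrt (n * (sqrt 2 * v)\<^sup>2))) std_normal_distribution"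
    using X_indep X_mean _ sq_int var X_distr
    by (rule central_limit_theorem_zero_mean) (use v_pos in simp)
  from bdd_in_prob_weak_conv[OF _ this real_dist_normal_dist]
  have bdd: "bdd_in_prob (\<lambda>n \<omega>. (\<Sum>j<n. X j \<omega>) / sqrt (n * (sqrt 2 * v)\<^sup>2))"
    by simp
  have "(\<lambda>n. sqrt 2 * v * (1 / sqrt (real n))) \<longlonglongrightarrow> sqrt 2 * v * 0"
    by (intro tendsto_intros inverse_sqrt_tendsto_0)
  then have "tends_in_prob (\<lambda>n \<omega>. sqrt 2 * v * (1 / sqrt (real n)) * ((\<Sum>j<n. X j \<omega>) / sqrt (n * (sqrt 2 * v)\<^sup>2))) 0"
    by (intro tends_in_prob_0_mult_bdd tends_in_prob_const bdd) auto
  then have "tends_in_prob (\<lambda>n \<omega>. sqrt 2 * v * (1 / sqrt (real n)) * ((\<Sum>j<n. X j \<omega>) / sqrt (n * (sqrt 2 * v)\<^sup>2)) + v) (0 + v)"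
    by (rule tends_in_prob_isCont[rotated]) auto
  then show ?thesis
    unfolding add_0
  proof (rule tends_in_prob_eq_on[where S="\<lambda>_. {}", rotated 2])
    show "\<forall>\<^sub>F n in sequentially. \<forall>\<omega>\<in>space M - {}. ee n \<omega> =
        sqrt 2 * v * (1 / sqrt (real n)) * ((\<Sum>j<n. X j \<omega>) / sqrt (n * (sqrt 2 * v)\<^sup>2)) + v"
      using eventually_gt_at_top[of 0]
    proof eventually_elim
      case (elim n)
      have "sqrt (n * (sqrt 2 * v)\<^sup>2) = sqrt n * (sqrt 2 * v)"
        using v_pos by (simp add: real_sqrt_mult)
      moreover have "c * (1 / r) * (x / (r * c)) = x / r\<^sup>2" if "c > 0" "r > 0" for c r x :: real
        using that by (simp add: field_simps power2_eq_square)
      ultimately have "sqrt 2 * v * (1 / sqrt (real n)) * ((\<Sum>j<n. X j \<omega>) / sqrt (n * (sqrt 2 * v)\<^sup>2)) = (\<Sum>j<n. X j \<omega>) / n" for \<omega>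
        using v_pos elim by simp
      then show ?case
        using elim by (simp add: X_def ee_def sum_subtractf diff_divide_distrib)
    qed
  qed auto
qed

text \<open>The Gaussian factor is bounded by 1 and tends in probability to a constant, so in the
  limit it leaves the expectation and only the explicit characteristic function of \<open>ze\<close>
  remains. The cross term carries \<open>ze / sqrt n\<close> and vanishes, which is why the three
  statistics are independent in the limit.\<close>

lemma integral_iexp_statistics_tendsto:
  "(\<lambda>n. CLINT \<omega>|M. iexp (a * ze n \<omega> + b * zf n \<omega> + c * ef n \<omega>))
    \<longlonglongrightarrow> of_real (exp (- (v * q * a\<^sup>2 + w * q * b\<^sup>2 + v * w * c\<^sup>2) / 2))"
proof -
  define V where "V n \<omega> = b\<^sup>2 * zz n + 2 * b * c * (ze n \<omega> / sqrt n) + c\<^sup>2 * ee n \<omega>" for n \<omega>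
  define V0 where "V0 = b\<^sup>2 * q + 2 * b * c * 0 + c\<^sup>2 * v"
  define D where "D n \<omega> = exp (- (w * V n \<omega>) / 2) - exp (- (w * V0) / 2)" for n \<omega>
  have [measurable]: "V n \<in> borel_measurable M" for n
    unfolding V_def[abs_def] by measurable
  have V_nonneg: "0 \<le> V n \<omega>" for n \<omega>
    unfolding V_def sum_sq_decomp[symmetric] by (intro sum_nonneg) auto
  have "0 \<le> V0"
    using q_nonneg v_pos by (simp add: V0_def)
  have "tends_in_prob (\<lambda>n \<omega>. (zz n, (ze n \<omega> / sqrt n, ee n \<omega>))) (q, (0, v))"
    by (intro tends_in_prob_Pair tends_in_prob_const zz_tendsto ze_div_tendsto_0 ee_tendsto) auto
  then have "tends_in_prob (\<lambda>n \<omega>. (\<lambda>(z, p, e). exp (- (w * (b\<^sup>2 * z + 2 * b * c * p + c\<^sup>2 * e)) / 2) - exp (- (w * V0) / 2)) (zz n, (ze n \<omega> / sqrt n, ee n \<omega>)))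
      ((\<lambda>(z, p, e). exp (- (w * (b\<^sup>2 * z + 2 * b * c * p + c\<^sup>2 * e)) / 2) - exp (- (w * V0) / 2)) (q, (0, v)))"
    unfolding case_prod_beta by (rule tends_in_prob_isCont[rotated]) (auto intro!: continuous_intros)
  then have "tends_in_prob D 0"
    by (simp add: D_def[abs_def] V_def V0_def)
  moreover have "\<bar>D n \<omega>\<bar> \<le> 1" for n \<omega>
  proof -
    have "\<bar>x - y\<bar> \<le> 1" if "0 < x" "x \<le> 1" "0 < y" "y \<le> 1" for x y :: real
      using that by auto
    then show ?thesis
      unfolding D_def using w_nonneg V_nonneg \<open>0 \<le> V0\<close> by simp
  qed
  ultimately have D_lim: "(\<lambda>n. expectation (\<lambda>\<omega>. norm (D n \<omega>))) \<longlonglongrightarrow> 0"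
    by (intro tends_in_prob_0_expectation_norm[where B=1]) (auto simp: D_def[abs_def])
  have ze_int: "integrable M (\<lambda>\<omega>. iexp (a * ze n \<omega>))" for n
    by (intro integrable_iexp) auto
  have prod_int: "integrable M (\<lambda>\<omega>. iexp (a * ze n \<omega>) * of_real (exp (- (w * V n \<omega>) / 2)))" for n
    using w_nonneg V_nonneg
    by (intro integrable_const_bound[where B=1]) (auto simp: norm_mult simp del: of_real_mult)
  have diff_lim: "(\<lambda>n. (CLINT \<omega>|M. iexp (a * ze n \<omega> + b * zf n \<omega> + c * ef n \<omega>))
      - (CLINT \<omega>|M. iexp (a * ze n \<omega>)) * of_real (exp (- (w * V0) / 2))) \<longlonglongrightarrow> 0"
  proof (rule Lim_null_comparison[OF _ D_lim], intro always_eventually allI)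
    fix n
    have "(CLINT \<omega>|M. iexp (a * ze n \<omega> + b * zf n \<omega> + c * ef n \<omega>))
        - (CLINT \<omega>|M. iexp (a * ze n \<omega>)) * of_real (exp (- (w * V0) / 2))
        = (CLINT \<omega>|M. iexp (a * ze n \<omega>) * of_real (exp (- (w * V n \<omega>) / 2)))
          - (CLINT \<omega>|M. iexp (a * ze n \<omega>) * of_real (exp (- (w * V0) / 2)))"
      unfolding integral_iexp_statistics V_def by simp
    also have "\<dots> = (CLINT \<omega>|M. iexp (a * ze n \<omega>) * of_real (D n \<omega>))"
      using prod_int ze_int by (subst Bochner_Integration.integral_diff[symmetric]) (auto simp: D_def algebra_simps)
    also have "norm \<dots> \<le> expectation (\<lambda>\<omega>. norm (iexp (a * ze n \<omega>) * of_real (D n \<omega>)))"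
      by (rule integral_norm_bound)
    also have "\<dots> = expectation (\<lambda>\<omega>. norm (D n \<omega>))"
      by (simp add: norm_mult del: of_real_mult)
    finally show "norm ((CLINT \<omega>|M. iexp (a * ze n \<omega> + b * zf n \<omega> + c * ef n \<omega>))
        - (CLINT \<omega>|M. iexp (a * ze n \<omega>)) * of_real (exp (- (w * V0) / 2))) \<le> expectation (\<lambda>\<omega>. norm (D n \<omega>))" .
  qed
  have "(\<lambda>n. (CLINT \<omega>|M. iexp (a * ze n \<omega>)) * of_real (exp (- (w * V0) / 2)))
      \<longlonglongrightarrow> of_real (exp (- (v * q * a\<^sup>2) / 2)) * of_real (exp (- (w * V0) / 2))"
    unfolding integral_iexp_ze by (intro tendsto_intros zz_tendsto) simp
  from tendsto_add[OF diff_lim this]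
  have "(\<lambda>n. CLINT \<omega>|M. iexp (a * ze n \<omega> + b * zf n \<omega> + c * ef n \<omega>))
      \<longlonglongrightarrow> 0 + of_real (exp (- (v * q * a\<^sup>2) / 2)) * of_real (exp (- (w * V0) / 2))"
    by (simp only: diff_add_cancel)
  also have "0 + of_real (exp (- (v * q * a\<^sup>2) / 2)) * of_real (exp (- (w * V0) / 2))
      = complex_of_real (exp (- (v * q * a\<^sup>2 + w * q * b\<^sup>2 + v * w * c\<^sup>2) / 2))"
    unfolding of_real_mult[symmetric] exp_add[symmetric] by (simp add: V0_def field_simps)
  finally show ?thesis .
qed

lemma bdd_zf: "bdd_in_prob zf"
  using integral_iexp_statistics_tendsto[of 0 _ 0] w_nonneg q_nonneg
  by (intro bdd_in_prob_normal_limit[where v="w * q"]) auto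

lemma bdd_ef: "bdd_in_prob ef"
  using integral_iexp_statistics_tendsto[of 0 0] w_nonneg v_pos
  by (intro bdd_in_prob_normal_limit[where v="v * w"]) auto

end

section \<open>Replacing random coefficients by their limits\<close>

context gaussian_error_array
begin

text \<open>Each coefficient minus its limit tends to 0 in probability and multiplies a
  stochastically bounded statistic. Off the events \<open>N n\<close>, \<open>S\<close> therefore
  differs from a combination with constant coefficients by a null sequence, which characteristic
  functions do not see in the limit.\<close>

lemma integral_iexp_slutsky:
  fixes S :: "nat \<Rightarrow> 'a \<Rightarrow> real" and h1 h2 h3 :: "real \<times> real \<times> real \<Rightarrow> real"
  assumes [measurable]: "\<And>n. S n \<in> borel_measurable M"
    and [measurable]: "h1 \<in> borel_measurable borel" "h2 \<in> borel_measurable borel" "h3 \<in> borel_measurable borel"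
    and cont: "isCont h1 (q, 0, v)" "isCont h2 (q, 0, v)" "isCont h3 (q, 0, v)"
    and [measurable]: "\<And>n. N n \<in> events" and N: "(\<lambda>n. prob (N n)) \<longlonglongrightarrow> 0"
    and eq: "\<forall>\<^sub>F n in sequentially. \<forall>\<omega>\<in>space M - N n. S n \<omega>
      = h1 (zz n, ze n \<omega> / sqrt n, ee n \<omega>) * ze n \<omega> + h2 (zz n, ze n \<omega> / sqrt n, ee n \<omega>) * zf n \<omega>
        + h3 (zz n, ze n \<omega> / sqrt n, ee n \<omega>) * ef n \<omega>"
  shows "(\<lambda>n. CLINT \<omega>|M. iexp (S n \<omega>)) \<longlonglongrightarrow> of_real (exp (- (v * q * (h1 (q, 0, v))\<^sup>2
      + w * q * (h2 (q, 0, v))\<^sup>2 + v * w * (h3 (q, 0, v))\<^sup>2) / 2))"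
proof -
  define c where "c = (q, 0 :: real, v)"
  define T where "T n \<omega> = (zz n, ze n \<omega> / sqrt n, ee n \<omega>)" for n \<omega>
  define L where "L n \<omega> = h1 c * ze n \<omega> + h2 c * zf n \<omega> + h3 c * ef n \<omega>" for n \<omega>
  have T_meas [measurable]: "T n \<in> borel_measurable M" for n
    unfolding T_def[abs_def] by measurable
  have T_lim: "tends_in_prob T c"
    unfolding T_def[abs_def] c_def
    by (intro tends_in_prob_Pair tends_in_prob_const zz_tendsto ze_div_tendsto_0 ee_tendsto) auto
  have coeff: "tends_in_prob (\<lambda>n \<omega>. (h (T n \<omega>) - h c) * Y n \<omega>) 0"
    if [measurable]: "h \<in> borel_measurable borel" "\<And>n. Y n \<in> borel_measurable M"
      and "isCont h c" "bdd_in_prob Y" for h Y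
  proof (rule tends_in_prob_0_mult_bdd)
    have "isCont (\<lambda>x. h x - h c) c"
      using \<open>isCont h c\<close> by (intro continuous_intros)
    from tends_in_prob_isCont[OF T_meas T_lim this] show "tends_in_prob (\<lambda>n \<omega>. h (T n \<omega>) - h c) 0"
      by simp
  qed (use that in auto)
  have "tends_in_prob (\<lambda>n \<omega>. (h1 (T n \<omega>) - h1 c) * ze n \<omega> + (h2 (T n \<omega>) - h2 c) * zf n \<omega>
      + (h3 (T n \<omega>) - h3 c) * ef n \<omega>) 0"
    using cont by (intro tends_in_prob_0_add coeff bdd_ze bdd_zf bdd_ef) (auto simp: c_def)
  then have "tends_in_prob (\<lambda>n \<omega>. S n \<omega> - L n \<omega>) 0"
  proof (rule tends_in_prob_eq_on[rotated 2])
    show "\<forall>\<^sub>F n in sequentially. \<forall>\<omega>\<in>space M - N n. S n \<omega> - L n \<omega>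
        = (h1 (T n \<omega>) - h1 c) * ze n \<omega> + (h2 (T n \<omega>) - h2 c) * zf n \<omega> + (h3 (T n \<omega>) - h3 c) * ef n \<omega>"
      using eq by eventually_elim (simp add: T_def L_def algebra_simps)
  qed (use N in auto)
  then have diff: "(\<lambda>n. (CLINT \<omega>|M. iexp (S n \<omega>)) - (CLINT \<omega>|M. iexp (L n \<omega>))) \<longlonglongrightarrow> 0"
    by (intro integral_iexp_diff_tendsto_0) (auto simp: L_def[abs_def])
  from tendsto_add[OF diff integral_iexp_statistics_tendsto[of "h1 c" "h2 c" "h3 c", folded L_def]]
  show ?thesis
    by (simp only: diff_add_cancel add_0 c_def)
qed

end

section \<open>The estimators\<close>

text \<open>Ordinary least squares for \<open>R = C Z + B M + \<gamma> E + F\<close>, \<open>M = A Z + E\<close>: since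
  \<open>\<gamma> E = \<gamma> M - \<gamma> A Z\<close>, the bias of the estimator of \<open>C\<close> is \<open>-\<gamma> A\<close>, and adding
  \<open>\<gamma> Z\<^sup>T M / Z\<^sup>T Z\<close> removes it up to \<open>\<gamma> Z\<^sup>T E / Z\<^sup>T Z\<close>.\<close>

lemma ols_corrected_error:
  fixes S U W G T A B C \<gamma> :: real
  assumes "S \<noteq> 0" "S * T - U\<^sup>2 \<noteq> 0"
  defines "ZM \<equiv> A * S + U"
    and "ZR \<equiv> C * S + B * (A * S + U) + \<gamma> * U + W"
    and "MM \<equiv> A\<^sup>2 * S + 2 * A * U + T"
    and "MR \<equiv> C * (A * S + U) + B * (A\<^sup>2 * S + 2 * A * U + T) + \<gamma> * (A * U + T) + (A * W + G)"
  shows "(MM * ZR - ZM * MR) / (S * MM - ZM\<^sup>2) + \<gamma> * ZM / S - C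
    = \<gamma> * U / S + ((A * U + T) * W - (A * S + U) * G) / (S * T - U\<^sup>2)"
proof -
  have den: "S * MM - ZM\<^sup>2 = S * T - U\<^sup>2"
    by (simp add: ZM_def MM_def power2_eq_square algebra_simps)
  have num: "MM * ZR - ZM * MR = (C - \<gamma> * A) * (S * T - U\<^sup>2) + ((A * U + T) * W - (A * S + U) * G)"
    by (simp add: ZM_def ZR_def MM_def MR_def power2_eq_square algebra_simps)
  have "\<gamma> * ZM / S = \<gamma> * A + \<gamma> * U / S"
    using assms(1) by (simp add: ZM_def field_simps)
  then show ?thesis
    unfolding den num using assms(2) by (simp add: add_divide_distrib)
qed

text \<open>Given the first error, the second has mean \<open>\<gamma>\<close> times the first and variance \<open>w\<close>.\<close>

lemma limit_covariance:
  fixes A B \<sigma>1 \<sigma>2 \<delta> q :: real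
  assumes "\<sigma>1 > 0" "q > 0"
  defines "\<gamma> \<equiv> \<delta> * \<sigma>2 / \<sigma>1" and "w \<equiv> \<sigma>2\<^sup>2 * (1 - \<delta>\<^sup>2)"
  shows "(B\<^sup>2 * \<sigma>1\<^sup>2 + 2 * B * \<delta> * \<sigma>1 * \<sigma>2 + \<sigma>2\<^sup>2) / q = ((B + \<gamma>)\<^sup>2 * \<sigma>1\<^sup>2 + w) / q"
    and "(\<sigma>2\<^sup>2 + B * \<delta> * \<sigma>1 * \<sigma>2) / q = ((B + \<gamma>) * \<gamma> * \<sigma>1\<^sup>2 + w) / q"
    and "\<sigma>2\<^sup>2 * (q * A\<^sup>2 + \<sigma>1\<^sup>2 - q * A\<^sup>2 * \<delta>\<^sup>2) / (q * \<sigma>1\<^sup>2)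
      = (\<gamma>\<^sup>2 * \<sigma>1\<^sup>2 + w) / q + A\<^sup>2 * w / \<sigma>1\<^sup>2"
  using assms(1,2) by (simp_all add: \<gamma>_def w_def power2_eq_square field_simps)

text \<open>Used with \<open>x = B + \<gamma>\<close> and \<open>y = \<gamma>\<close>. On the right,
  the squared factors are the limiting coefficients of \<open>ze\<close>, \<open>zf\<close> and
  \<open>ef\<close> in \<open>s * X1 + t * X2\<close>, weighted by the limiting variances of these
  statistics.\<close>

lemma limit_covariance_quadratic_form:
  fixes v w q x y A s t :: real
  assumes "v > 0" "q > 0"
  shows "s\<^sup>2 * ((x\<^sup>2 * v + w) / q) + 2 * s * t * ((x * y * v + w) / q) + t\<^sup>2 * ((y\<^sup>2 * v + w) / q + A\<^sup>2 * w / v)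
    = v * q * ((s * x + t * y) / q)\<^sup>2 + w * q * ((s + t) / q)\<^sup>2 + v * w * (- (t * A / v))\<^sup>2"
  using assms by (simp add: power2_eq_square field_simps)

text \<open>The determinant is a sum of two nonnegative terms, the first from the common noise in
  \<open>ze\<close> and \<open>zf\<close>, the second from \<open>ef\<close>.\<close>

lemma limit_covariance_psd:
  fixes v w q x y A :: real
  assumes "v > 0" "q > 0" "w \<ge> 0"
  shows "((x * y * v + w) / q)\<^sup>2 \<le> ((x\<^sup>2 * v + w) / q) * ((y\<^sup>2 * v + w) / q + A\<^sup>2 * w / v)"
proof -
  have "((x\<^sup>2 * v + w) / q) * ((y\<^sup>2 * v + w) / q + A\<^sup>2 * w / v) - ((x * y * v + w) / q)\<^sup>2
      = v * w * (x - y)\<^sup>2 / q\<^sup>2 + ((x\<^sup>2 * v + w) / q) * (A\<^sup>2 * w / v)"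
    using assms by (simp add: power2_eq_square field_simps)
  also have "\<dots> \<ge> 0"
    using assms by simp
  finally show ?thesis by simp
qed

section \<open>Estimation errors in terms of the normalised statistics\<close>

context gaussian_error_array
begin

lemma estimator_errors:
  fixes A B C \<gamma> :: real
  assumes "n > 0" "zz n \<noteq> 0" "zz n * ee n \<omega> - (ze n \<omega> / sqrt n)\<^sup>2 \<noteq> 0"
    and Mv: "\<And>j. Mv j = Z n j * A + E j \<omega>"
    and Rv: "\<And>j. Rv j = Z n j * C + Mv j * B + (\<gamma> * E j \<omega> + F j \<omega>)"
  defines "ZZ \<equiv> \<Sum>j<n. Z n j * Z n j" and "ZM \<equiv> \<Sum>j<n. Z n j * Mv j" and "ZR \<equiv> \<Sum>j<n. Z n j * Rv j"
    and "MM \<equiv> \<Sum>j<n. Mv j * Mv j" and "MR \<equiv> \<Sum>j<n. Mv j * Rv j"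
  shows "sqrt n * (ZR / ZZ - (C + A * B)) = ((B + \<gamma>) * ze n \<omega> + zf n \<omega>) / zz n"
    and "sqrt n * ((MM * ZR - ZM * MR) / (ZZ * MM - ZM\<^sup>2) + \<gamma> * ZM / ZZ - C)
      = \<gamma> * ze n \<omega> / zz n + ((A * (ze n \<omega> / sqrt n) + ee n \<omega>) * zf n \<omega> - (A * zz n + ze n \<omega> / sqrt n) * ef n \<omega>)
          / (zz n * ee n \<omega> - (ze n \<omega> / sqrt n)\<^sup>2)"
proof -
  define r where "r = sqrt n"
  define p where "p = ze n \<omega> / r"
  have "r > 0" and r2: "real n = r\<^sup>2"
    using \<open>n > 0\<close> by (auto simp: r_def)
  define T where "T = (\<Sum>j<n. (E j \<omega>)\<^sup>2)"
  define U where "U = (\<Sum>j<n. Z n j * E j \<omega>)"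
  define W where "W = (\<Sum>j<n. Z n j * F j \<omega>)"
  define G where "G = (\<Sum>j<n. E j \<omega> * F j \<omega>)"
  \<comment> \<open>\<open>U\<close> is kept in two scalings: \<open>r * ze\<close> where it is a
    fluctuation of order \<open>sqrt n\<close>, and \<open>r^2 * p\<close> where it enters a
    coefficient next to \<open>ZZ\<close> and \<open>T\<close>.\<close>
  have S: "ZZ = r\<^sup>2 * zz n" and T: "T = r\<^sup>2 * ee n \<omega>" and U: "U = r\<^sup>2 * p" "U = r * ze n \<omega>"
    and W: "W = r * zf n \<omega>" and G: "G = r * ef n \<omega>"
    using \<open>r > 0\<close> unfolding ZZ_def T_def U_def W_def G_def p_def zz_def ze_def zf_def ef_def ee_def r_def[symmetric] r2
    by (simp_all add: power2_eq_square)
  note distrib = sum.distrib sum_distrib_left sum_distrib_right power2_eq_square algebra_simps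
  have ZM: "ZM = A * ZZ + U"
    by (simp add: ZM_def ZZ_def U_def Mv distrib)
  have ZR: "ZR = C * ZZ + B * (A * ZZ + U) + \<gamma> * U + W"
    by (simp add: ZR_def ZZ_def U_def W_def Mv Rv distrib)
  have MM: "MM = A\<^sup>2 * ZZ + 2 * A * U + T"
    by (simp add: MM_def ZZ_def U_def T_def Mv distrib)
  have MR: "MR = C * (A * ZZ + U) + B * (A\<^sup>2 * ZZ + 2 * A * U + T) + \<gamma> * (A * U + T) + (A * W + G)"
    by (simp add: MR_def ZZ_def U_def T_def W_def G_def Mv Rv distrib)
  have ZZ_nz: "ZZ \<noteq> 0"
    using S \<open>r > 0\<close> assms(2) by simp
  have D: "ZZ * T - U\<^sup>2 = r ^ 4 * (zz n * ee n \<omega> - p\<^sup>2)"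
    unfolding S T U(1) by (simp add: power2_eq_square power4_eq_xxxx algebra_simps)
  have D_nz: "zz n * ee n \<omega> - p\<^sup>2 \<noteq> 0"
    using assms(3) by (simp add: p_def r_def)
  have "ZR / ZZ - (C + A * B) = ((B + \<gamma>) * U + W) / ZZ"
    unfolding ZR using ZZ_nz by (simp add: field_simps)
  then show "sqrt n * (ZR / ZZ - (C + A * B)) = ((B + \<gamma>) * ze n \<omega> + zf n \<omega>) / zz n"
    unfolding r_def[symmetric] S U(2) W using \<open>r > 0\<close> assms(2) by (simp add: field_simps power2_eq_square)
  have "(MM * ZR - ZM * MR) / (ZZ * MM - ZM\<^sup>2) + \<gamma> * ZM / ZZ - C
      = \<gamma> * U / ZZ + ((A * U + T) * W - (A * ZZ + U) * G) / (ZZ * T - U\<^sup>2)"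
    unfolding ZM ZR MM MR using ZZ_nz D D_nz \<open>r > 0\<close> by (intro ols_corrected_error) auto
  moreover have "r * (\<gamma> * U / ZZ) = \<gamma> * ze n \<omega> / zz n"
    unfolding S U(2) using \<open>r > 0\<close> assms(2) by (simp add: field_simps power2_eq_square)
  moreover have "r * (((A * U + T) * W - (A * ZZ + U) * G) / (ZZ * T - U\<^sup>2))
      = ((A * p + ee n \<omega>) * zf n \<omega> - (A * zz n + p) * ef n \<omega>) / (zz n * ee n \<omega> - p\<^sup>2)"
  proof -
    \<comment> \<open>The coefficients contribute \<open>r^2\<close>, the statistics
      \<open>W\<close> and \<open>G\<close> one \<open>r\<close>, and the scaling by
      \<open>sqrt n\<close> another; the determinant in the denominator has order \<open>r^4\<close>
      too, so all powers cancel.\<close>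
    have "r * ((A * U + T) * W - (A * ZZ + U) * G)
        = r ^ 4 * ((A * p + ee n \<omega>) * zf n \<omega> - (A * zz n + p) * ef n \<omega>)"
      unfolding S T U(1) W G by (simp add: power2_eq_square power4_eq_xxxx algebra_simps)
    then show ?thesis
      unfolding D times_divide_eq_right using \<open>r > 0\<close> by simp
  qed
  ultimately show "sqrt n * ((MM * ZR - ZM * MR) / (ZZ * MM - ZM\<^sup>2) + \<gamma> * ZM / ZZ - C)
      = \<gamma> * ze n \<omega> / zz n + ((A * (ze n \<omega> / sqrt n) + ee n \<omega>) * zf n \<omega> - (A * zz n + ze n \<omega> / sqrt n) * ef n \<omega>)
          / (zz n * ee n \<omega> - (ze n \<omega> / sqrt n)\<^sup>2)"
    unfolding r_def[symmetric] p_def[symmetric] by (simp only: distrib_left)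
qed

text \<open>The normalised Gram determinant of \<open>Z\<close> and \<open>E\<close> tends in
  probability to \<open>q * v > 0\<close>, and vanishing means a deviation of exactly
  \<open>q * v\<close>.\<close>

lemma prob_degenerate_tendsto_0:
  assumes "q > 0"
  shows "(\<lambda>n. prob {\<omega> \<in> space M. zz n * ee n \<omega> - (ze n \<omega> / sqrt n)\<^sup>2 = 0}) \<longlonglongrightarrow> 0"
proof (rule tendsto_sandwich[OF _ _ tendsto_const])
  let ?h = "\<lambda>x :: real \<times> real \<times> real. fst x * snd (snd x) - (fst (snd x))\<^sup>2"
  have "tends_in_prob (\<lambda>n \<omega>. (zz n, ze n \<omega> / sqrt n, ee n \<omega>)) (q, 0, v)"
    by (intro tends_in_prob_Pair tends_in_prob_const zz_tendsto ze_div_tendsto_0 ee_tendsto) auto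
  then have "tends_in_prob (\<lambda>n \<omega>. ?h (zz n, ze n \<omega> / sqrt n, ee n \<omega>)) (?h (q, 0, v))"
    by (rule tends_in_prob_isCont[rotated]) (auto intro!: continuous_intros)
  then show "(\<lambda>n. prob {\<omega> \<in> space M. q * v \<le> dist (zz n * ee n \<omega> - (ze n \<omega> / sqrt n)\<^sup>2) (q * v)}) \<longlonglongrightarrow> 0"
    using assms v_pos unfolding tends_in_prob_def by simp
  show "\<forall>\<^sub>F n in sequentially. prob {\<omega> \<in> space M. zz n * ee n \<omega> - (ze n \<omega> / sqrt n)\<^sup>2 = 0}
      \<le> prob {\<omega> \<in> space M. q * v \<le> dist (zz n * ee n \<omega> - (ze n \<omega> / sqrt n)\<^sup>2) (q * v)}"
    using assms v_pos by (intro always_eventually allI finite_measure_mono) (auto simp: dist_real_def)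
qed simp

end

section \<open>From the correlated error model to the limit law\<close>

lemma gaussian_error_arrayI:
  fixes E1 E2 :: "nat \<Rightarrow> 'a \<Rightarrow> real"
  assumes "prob_space P" "\<sigma>1 > 0" "-1 < \<delta>" "\<delta> < 1"
    and indep: "prob_space.indep_vars P (\<lambda>_. borel) (\<lambda>j \<omega>. (E1 j \<omega>, E2 j \<omega>)) UNIV"
    and meas: "\<And>j. (\<lambda>\<omega>. (E1 j \<omega>, E2 j \<omega>)) \<in> borel_measurable P"
    and law: "\<And>j. gaussian2 (distr P borel (\<lambda>\<omega>. (E1 j \<omega>, E2 j \<omega>)))
                 (\<sigma>1\<^sup>2) (\<delta> * \<sigma>1 * \<sigma>2) (\<sigma>2\<^sup>2)"
    and Z: "(\<lambda>n. (\<Sum>j<n. (Z n j)\<^sup>2) / real n) \<longlonglongrightarrow> q"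
  shows "gaussian_error_array P E1 (\<lambda>j \<omega>. E2 j \<omega> - \<delta> * \<sigma>2 / \<sigma>1 * E1 j \<omega>) Z (\<sigma>1\<^sup>2) (\<sigma>2\<^sup>2 * (1 - \<delta>\<^sup>2)) q"
proof -
  interpret prob_space P by fact
  define \<gamma> where "\<gamma> = \<delta> * \<sigma>2 / \<sigma>1"
  have w: "0 \<le> \<sigma>2\<^sup>2 * (1 - \<delta>\<^sup>2)"
    using assms(3,4) abs_square_le_1[of \<delta>] by auto
  have "(\<lambda>z :: real \<times> real. (fst z, snd z - \<gamma> * fst z)) \<in> borel_measurable borel"
    by (intro borel_measurable_continuous_onI continuous_intros)
  then have "indep_vars (\<lambda>_. borel) (\<lambda>j \<omega>. (E1 j \<omega>, E2 j \<omega> - \<gamma> * E1 j \<omega>)) UNIV"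
    using indep_vars_compose2[OF indep, of "\<lambda>_ z. (fst z, snd z - \<gamma> * fst z)" "\<lambda>_. borel"] by simp
  moreover have "(CLINT \<omega>|P. iexp (s * E1 j \<omega> + t * (E2 j \<omega> - \<gamma> * E1 j \<omega>)))
      = of_real (exp (- (\<sigma>1\<^sup>2 * s\<^sup>2 + \<sigma>2\<^sup>2 * (1 - \<delta>\<^sup>2) * t\<^sup>2) / 2))" for j s t
  proof -
    let ?D = "distr P borel (\<lambda>\<omega>. (E1 j \<omega>, E2 j \<omega>))"
    \<comment> \<open>The pair formed by \<open>E1\<close> and the residual has at
      \<open>(s, t)\<close> the characteristic function of the original pair at
      \<open>(s - t * \<gamma>, t)\<close>; this choice of \<open>\<gamma>\<close> is the regression
      coefficient that removes the cross term.\<close>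
    have var: "(s - t * \<gamma>)\<^sup>2 * \<sigma>1\<^sup>2 + 2 * (s - t * \<gamma>) * t * (\<delta> * \<sigma>1 * \<sigma>2) + t\<^sup>2 * \<sigma>2\<^sup>2
        = \<sigma>1\<^sup>2 * s\<^sup>2 + \<sigma>2\<^sup>2 * (1 - \<delta>\<^sup>2) * t\<^sup>2"
      using assms(2) by (simp add: \<gamma>_def power2_eq_square field_simps)
    have "(CLINT \<omega>|P. iexp (s * E1 j \<omega> + t * (E2 j \<omega> - \<gamma> * E1 j \<omega>)))
        = (CLINT \<omega>|P. iexp ((s - t * \<gamma>) * fst (E1 j \<omega>, E2 j \<omega>) + t * snd (E1 j \<omega>, E2 j \<omega>)))"
      by (simp add: algebra_simps)
    also have "\<dots> = (CLINT z|?D. iexp ((s - t * \<gamma>) * fst z + t * snd z))"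
      using meas by (intro integral_distr[symmetric] borel_measurable_continuous_onI continuous_intros)
    also have "\<dots> = of_real (exp (- ((s - t * \<gamma>)\<^sup>2 * \<sigma>1\<^sup>2 + 2 * (s - t * \<gamma>) * t * (\<delta> * \<sigma>1 * \<sigma>2) + t\<^sup>2 * \<sigma>2\<^sup>2) / 2))"
    proof (rule gaussian2_integral_iexp[OF law])
      show "0 \<le> (s - t * \<gamma>)\<^sup>2 * \<sigma>1\<^sup>2 + 2 * (s - t * \<gamma>) * t * (\<delta> * \<sigma>1 * \<sigma>2) + t\<^sup>2 * \<sigma>2\<^sup>2"
        unfolding var using w by simp
    qed
    finally show ?thesis
      unfolding var .
  qed
  ultimately show ?thesis
    unfolding \<gamma>_def using w assms(2) Z by unfold_locales auto
qed

theorem theorem3: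
  fixes P :: "'a measure"
    and E1 E2 :: "nat \<Rightarrow> 'a \<Rightarrow> real"
    and Z :: "nat \<Rightarrow> nat \<Rightarrow> real"
    and A B C \<sigma>1 \<sigma>2 \<delta> q :: real
  assumes "prob_space P"
    and "\<sigma>1 > 0" and "\<sigma>2 > 0" and "-1 < \<delta>" and "\<delta> < 1"
    and "prob_space.indep_vars P (\<lambda>_. borel) (\<lambda>j \<omega>. (E1 j \<omega>, E2 j \<omega>)) UNIV"
    and "\<And>j. (\<lambda>\<omega>. (E1 j \<omega>, E2 j \<omega>)) \<in> borel_measurable P"
    and "\<And>j. gaussian2 (distr P borel (\<lambda>\<omega>. (E1 j \<omega>, E2 j \<omega>)))
                 (\<sigma>1\<^sup>2) (\<delta> * \<sigma>1 * \<sigma>2) (\<sigma>2\<^sup>2)"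
    and "q > 0"
    and "(\<lambda>n. (\<Sum>j<n. (Z n j)\<^sup>2) / real n) \<longlonglongrightarrow> q"
  shows
    "let Mv = (\<lambda>n j \<omega>. Z n j * A + E1 j \<omega>);
         Rv = (\<lambda>n j \<omega>. Z n j * C + Mv n j \<omega> * B + E2 j \<omega>);
         ZZ = (\<lambda>n. \<Sum>j<n. Z n j * Z n j);
         ZM = (\<lambda>n \<omega>. \<Sum>j<n. Z n j * Mv n j \<omega>);
         ZR = (\<lambda>n \<omega>. \<Sum>j<n. Z n j * Rv n j \<omega>);
         MM = (\<lambda>n \<omega>. \<Sum>j<n. Mv n j \<omega> * Mv n j \<omega>);
         MR = (\<lambda>n \<omega>. \<Sum>j<n. Mv n j \<omega> * Rv n j \<omega>);
         Chat' = (\<lambda>n \<omega>. ZR n \<omega> / ZZ n);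
         Chat = (\<lambda>n \<omega>. (MM n \<omega> * ZR n \<omega> - ZM n \<omega> * MR n \<omega>)
                          / (ZZ n * MM n \<omega> - (ZM n \<omega>)\<^sup>2)
                        + \<delta> * \<sigma>2 * ZM n \<omega> / (\<sigma>1 * ZZ n));
         X = (\<lambda>n \<omega>. (sqrt (real n) * (Chat' n \<omega> - (C + A * B)),
                      sqrt (real n) * (Chat n \<omega> - C)))
     in \<exists>\<mu>. gaussian2 \<mu>
              ((B\<^sup>2 * \<sigma>1\<^sup>2 + 2 * B * \<delta> * \<sigma>1 * \<sigma>2 + \<sigma>2\<^sup>2) / q)
              ((\<sigma>2\<^sup>2 + B * \<delta> * \<sigma>1 * \<sigma>2) / q)
              (\<sigma>2\<^sup>2 * (q * A\<^sup>2 + \<sigma>1\<^sup>2 - q * A\<^sup>2 * \<delta>\<^sup>2) / (q * \<sigma>1\<^sup>2))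
            \<and> conv_distr2 P X \<mu>"
proof -
  define \<gamma> where "\<gamma> = \<delta> * \<sigma>2 / \<sigma>1"
  define w where "w = \<sigma>2\<^sup>2 * (1 - \<delta>\<^sup>2)"
  define F where "F j \<omega> = E2 j \<omega> - \<gamma> * E1 j \<omega>" for j \<omega>
  interpret gaussian_error_array P E1 F Z "\<sigma>1\<^sup>2" w q
    unfolding F_def[abs_def] \<gamma>_def w_def using assms by (intro gaussian_error_arrayI)
  have E2_eq: "E2 j \<omega> = \<gamma> * E1 j \<omega> + F j \<omega>" for j \<omega>
    by (simp add: F_def)
  then have [measurable]: "E2 j \<in> borel_measurable P" for j
    by (simp add: fun_eq_iff[symmetric] E2_eq[abs_def])
  define Mv where "Mv = (\<lambda>n j \<omega>. Z n j * A + E1 j \<omega>)"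
  define Rv where "Rv = (\<lambda>n j \<omega>. Z n j * C + Mv n j \<omega> * B + E2 j \<omega>)"
  define ZZ where "ZZ = (\<lambda>n. \<Sum>j<n. Z n j * Z n j)"
  define ZM where "ZM = (\<lambda>n \<omega>. \<Sum>j<n. Z n j * Mv n j \<omega>)"
  define ZR where "ZR = (\<lambda>n \<omega>. \<Sum>j<n. Z n j * Rv n j \<omega>)"
  define MM where "MM = (\<lambda>n \<omega>. \<Sum>j<n. Mv n j \<omega> * Mv n j \<omega>)"
  define MR where "MR = (\<lambda>n \<omega>. \<Sum>j<n. Mv n j \<omega> * Rv n j \<omega>)"
  define X1 where "X1 = (\<lambda>n \<omega>. sqrt (real n) * (ZR n \<omega> / ZZ n - (C + A * B)))"
  define X2 where "X2 = (\<lambda>n \<omega>. sqrt (real n) * ((MM n \<omega> * ZR n \<omega> - ZM n \<omega> * MR n \<omega>)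
                          / (ZZ n * MM n \<omega> - (ZM n \<omega>)\<^sup>2)
                        + \<delta> * \<sigma>2 * ZM n \<omega> / (\<sigma>1 * ZZ n) - C))"
  note defs = X1_def X2_def MR_def MM_def ZR_def ZM_def ZZ_def Rv_def Mv_def
  have meas [measurable]: "X1 n \<in> borel_measurable P" "X2 n \<in> borel_measurable P" for n
    unfolding defs by measurable
  have X_meas: "(\<lambda>\<omega>. (X1 n \<omega>, X2 n \<omega>)) \<in> borel_measurable P" for n
    by measurable

  \<comment> \<open>The covariances in terms of \<open>\<gamma>\<close> and \<open>w\<close>, in
    which the limiting exponent appears; \<open>limit_covariance\<close> turns them into the stated
    entries at the end.\<close>
  define v11 where "v11 = ((B + \<gamma>)\<^sup>2 * \<sigma>1\<^sup>2 + w) / q"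
  define v12 where "v12 = ((B + \<gamma>) * \<gamma> * \<sigma>1\<^sup>2 + w) / q"
  define v22 where "v22 = (\<gamma>\<^sup>2 * \<sigma>1\<^sup>2 + w) / q + A\<^sup>2 * w / \<sigma>1\<^sup>2"
  have quad: "s\<^sup>2 * v11 + 2 * s * t * v12 + t\<^sup>2 * v22
      = \<sigma>1\<^sup>2 * q * ((s * (B + \<gamma>) + t * \<gamma>) / q)\<^sup>2 + w * q * ((s + t) / q)\<^sup>2 + \<sigma>1\<^sup>2 * w * (- (t * A / \<sigma>1\<^sup>2))\<^sup>2" for s t
    unfolding v11_def v12_def v22_def using v_pos \<open>q > 0\<close> by (rule limit_covariance_quadratic_form)
  have "v12\<^sup>2 \<le> v11 * v22"
    unfolding v11_def v12_def v22_def using v_pos \<open>q > 0\<close> w_nonneg by (rule limit_covariance_psd)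
  then obtain \<mu> where \<mu>: "gaussian2 \<mu> v11 v12 v22"
    using gaussian2_exists[of v11 v22 v12] w_nonneg \<open>q > 0\<close> by (auto simp: v11_def v22_def)
  then have \<mu>_prob: "prob_space \<mu>" "sets \<mu> = sets borel"
    by (auto simp: gaussian2_def)

  have char_lim: "(\<lambda>n. CLINT \<omega>|P. iexp (s * X1 n \<omega> + t * X2 n \<omega>))
      \<longlonglongrightarrow> (CLINT z|\<mu>. iexp (s * fst z + t * snd z))" for s t
  proof -
    \<comment> \<open>Obtained by collecting the coefficients of \<open>ze\<close>,
      \<open>zf\<close> and \<open>ef\<close> in \<open>s * X1 + t * X2\<close>. All randomness in
      them goes through the triple that tends to \<open>(q, 0, \<sigma>1^2)\<close>.\<close>
    let ?h1 = "\<lambda>x :: real \<times> real \<times> real. (s * (B + \<gamma>) + t * \<gamma>) / fst x"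
    let ?h2 = "\<lambda>x :: real \<times> real \<times> real. s / fst x
      + t * (A * fst (snd x) + snd (snd x)) / (fst x * snd (snd x) - (fst (snd x))\<^sup>2)"
    let ?h3 = "\<lambda>x :: real \<times> real \<times> real. - (t * (A * fst x + fst (snd x)) / (fst x * snd (snd x) - (fst (snd x))\<^sup>2))"
    let ?N = "\<lambda>n. {\<omega> \<in> space P. zz n * ee n \<omega> - (ze n \<omega> / sqrt n)\<^sup>2 = 0}"
    have "(\<lambda>n. CLINT \<omega>|P. iexp (s * X1 n \<omega> + t * X2 n \<omega>))
        \<longlonglongrightarrow> of_real (exp (- (\<sigma>1\<^sup>2 * q * (?h1 (q, 0, \<sigma>1\<^sup>2))\<^sup>2 + w * q * (?h2 (q, 0, \<sigma>1\<^sup>2))\<^sup>2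
          + \<sigma>1\<^sup>2 * w * (?h3 (q, 0, \<sigma>1\<^sup>2))\<^sup>2) / 2))"
    proof (rule integral_iexp_slutsky)
      show "?h1 \<in> borel_measurable borel" "?h2 \<in> borel_measurable borel" "?h3 \<in> borel_measurable borel"
        unfolding borel_prod[symmetric] by measurable
      show "isCont ?h1 (q, 0, \<sigma>1\<^sup>2)" "isCont ?h2 (q, 0, \<sigma>1\<^sup>2)" "isCont ?h3 (q, 0, \<sigma>1\<^sup>2)"
        using v_pos \<open>q > 0\<close> by (intro continuous_intros; simp)+
      show "(\<lambda>n. prob (?N n)) \<longlonglongrightarrow> 0"
        using \<open>q > 0\<close> by (rule prob_degenerate_tendsto_0)
      show "\<forall>\<^sub>F n in sequentially. \<forall>\<omega>\<in>space P - ?N n. s * X1 n \<omega> + t * X2 n \<omega>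
          = ?h1 (zz n, ze n \<omega> / sqrt n, ee n \<omega>) * ze n \<omega> + ?h2 (zz n, ze n \<omega> / sqrt n, ee n \<omega>) * zf n \<omega>
            + ?h3 (zz n, ze n \<omega> / sqrt n, ee n \<omega>) * ef n \<omega>"
        \<comment> \<open>Since \<open>q > 0\<close>, the deterministic denominator
          \<open>zz n\<close> is eventually positive; only the Gram determinant requires an
          exceptional event.\<close>
        using eventually_gt_at_top[of 0] order_tendstoD(1)[OF zz_tendsto \<open>q > 0\<close>]
      proof eventually_elim
        case (elim n)
        show ?case
        proof
          fix \<omega> assume "\<omega> \<in> space P - ?N n"
          then have nz: "zz n * ee n \<omega> - (ze n \<omega> / sqrt n)\<^sup>2 \<noteq> 0"
            by simp
          have Mv: "Mv n j \<omega> = Z n j * A + E1 j \<omega>"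
            and Rv: "Rv n j \<omega> = Z n j * C + Mv n j \<omega> * B + (\<gamma> * E1 j \<omega> + F j \<omega>)" for j
            by (simp_all add: Mv_def Rv_def E2_eq)
          have gamma: "\<delta> * \<sigma>2 * ZM n \<omega> / (\<sigma>1 * ZZ n) = \<gamma> * ZM n \<omega> / ZZ n"
            by (simp add: \<gamma>_def)
          have X1: "X1 n \<omega> = ((B + \<gamma>) * ze n \<omega> + zf n \<omega>) / zz n"
            using estimator_errors(1)[OF _ _ nz Mv Rv] elim by (simp add: X1_def ZR_def ZZ_def)
          have X2: "X2 n \<omega> = \<gamma> * ze n \<omega> / zz n
              + ((A * (ze n \<omega> / sqrt n) + ee n \<omega>) * zf n \<omega> - (A * zz n + ze n \<omega> / sqrt n) * ef n \<omega>)
                / (zz n * ee n \<omega> - (ze n \<omega> / sqrt n)\<^sup>2)"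
            unfolding X2_def gamma unfolding ZR_def ZZ_def ZM_def MM_def MR_def
            using estimator_errors(2)[OF _ _ nz Mv Rv] elim by simp
          have "s * (((B + \<gamma>) * u + f) / z) + t * (\<gamma> * u / z + ((A * p + e) * f - (A * z + p) * g) / d)
              = (s * (B + \<gamma>) + t * \<gamma>) / z * u + (s / z + t * (A * p + e) / d) * f + - (t * (A * z + p) / d) * g"
            for u f g z p e d :: real
            by (simp add: add_divide_distrib diff_divide_distrib algebra_simps)
          then show "s * X1 n \<omega> + t * X2 n \<omega>
            = ?h1 (zz n, ze n \<omega> / sqrt n, ee n \<omega>) * ze n \<omega> + ?h2 (zz n, ze n \<omega> / sqrt n, ee n \<omega>) * zf n \<omega>
              + ?h3 (zz n, ze n \<omega> / sqrt n, ee n \<omega>) * ef n \<omega>"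
            unfolding X1 X2 fst_conv snd_conv .
        qed
      qed
    qed measurable
    \<comment> \<open>At the limit point \<open>?h2\<close> collapses to \<open>(s + t) / q\<close>
      and \<open>?h3\<close> to \<open>- (t * A / \<sigma>1^2)\<close>.\<close>
    also have "\<sigma>1\<^sup>2 * q * (?h1 (q, 0, \<sigma>1\<^sup>2))\<^sup>2 + w * q * (?h2 (q, 0, \<sigma>1\<^sup>2))\<^sup>2 + \<sigma>1\<^sup>2 * w * (?h3 (q, 0, \<sigma>1\<^sup>2))\<^sup>2
        = s\<^sup>2 * v11 + 2 * s * t * v12 + t\<^sup>2 * v22"
      unfolding quad using v_pos \<open>q > 0\<close> by (simp add: add_divide_distrib)
    also have "of_real (exp (- (s\<^sup>2 * v11 + 2 * s * t * v12 + t\<^sup>2 * v22) / 2)) = (CLINT z|\<mu>. iexp (s * fst z + t * snd z))"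
    proof (rule gaussian2_integral_iexp[OF \<mu>, symmetric])
      show "0 \<le> s\<^sup>2 * v11 + 2 * s * t * v12 + t\<^sup>2 * v22"
        unfolding quad using v_pos w_nonneg \<open>q > 0\<close> by (intro add_nonneg_nonneg mult_nonneg_nonneg) auto
    qed
    finally show ?thesis .
  qed

  have "conv_distr2 P (\<lambda>n \<omega>. (X1 n \<omega>, X2 n \<omega>)) \<mu>"
    unfolding conv_distr2_def
  proof (intro allI impI)
    fix f :: "real \<times> real \<Rightarrow> real"
    assume f: "continuous_on UNIV f \<and> bounded (range f)"
    let ?D = "\<lambda>n. distr P borel (\<lambda>\<omega>. (X1 n \<omega>, X2 n \<omega>))"
    have D_int: "(CLINT z|?D n. iexp (s * fst z + t * snd z)) = (CLINT \<omega>|P. iexp (s * X1 n \<omega> + t * X2 n \<omega>))" for n s t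
      using X_meas by (subst integral_distr) (auto intro!: borel_measurable_continuous_onI continuous_intros)
    have "(\<lambda>n. \<integral>z. f z \<partial>?D n) \<longlonglongrightarrow> (\<integral>z. f z \<partial>\<mu>)"
      using f X_meas char_lim unfolding D_int[symmetric]
      by (intro levy_continuity_prod \<mu>_prob prob_space_distr) auto
    then show "(\<lambda>n. \<integral>\<omega>. f (X1 n \<omega>, X2 n \<omega>) \<partial>P) \<longlonglongrightarrow> (\<integral>z. f z \<partial>\<mu>)"
      using f X_meas by (subst (asm) integral_distr) (auto intro: borel_measurable_continuous_onI)
  qed
  with \<mu> have "\<exists>\<mu>. gaussian2 \<mu> v11 v12 v22 \<and> conv_distr2 P (\<lambda>n \<omega>. (X1 n \<omega>, X2 n \<omega>)) \<mu>"
    by blast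
  then show ?thesis
    unfolding Let_def defs v11_def v12_def v22_def \<gamma>_def w_def
      limit_covariance[OF \<open>\<sigma>1 > 0\<close> \<open>q > 0\<close>] .
qed

end
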